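(* There is a deterministic online algorithm for $\mathrm{DMCD}$ on directed line networks that is $O\!\left(\min\left\{\frac{\log N}{\log\log N},\frac{\log n}{\log\log n}\right\}\right)$-competitive, where $n$ is the number of network nodes and $N$ the number of requests; this ratio is asymptotically optimal for deterministic online algorithms.
   Context: Time-line graph: for a directed line network with nodes $1,\dots,n$ (edges $(u,u+1)$), the time-line graph has replicas $(v,t)$ for every node $v$ and $t\in\{0,1,2,\dots\}$, horizontal edges $((u,t),(u+1,t))$ and arcs $((v,t),(v,t+1))$. DMCD: given an origin node $v_0$ and a set of requests (replicas), a feasible solution is a set $F$ of edges such that every request is reachable from $(v_0,0)$ by a directed path in $F$; the cost is $|F|$. Online model: requests $r_1=(v_1,t_1),\dots,r_N=(v_N,t_N)$ arrive with $t_1\le\dots\le t_N$, and a clock announces when time $t$ has ended. When a request at time $t$ arrives the algorithm, knowing only past requests and its current solution, may add only horizontal edges at time $t$; when time $t$ ends it may add arcs from time $t$ to $t+1$; it can never delete edges nor add edges with endpoints at earlier times. An online algorithm is $c$-competitive if its cost is at most $c$ times the optimal cost on every input. *)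

theory Defs
  imports Complex_Main
begin

text \<open>A replica \<open>(v, t)\<close> is node \<open>v\<close> at time \<open>t\<close>; the nodes of the line are \<open>1, \<dots>, n\<close>.\<close>

type_synonym replica = "nat \<times> nat"
type_synonym edge = "replica \<times> replica"

definition replicas :: "nat \<Rightarrow> replica set" where
  "replicas n = {(v, t). 1 \<le> v \<and> v \<le> n}"

definition horizontal_edges :: "nat \<Rightarrow> nat \<Rightarrow> edge set" where
  "horizontal_edges n t = {((u, t), (u + 1, t)) | u. 1 \<le> u \<and> u + 1 \<le> n}"

definition arcs :: "nat \<Rightarrow> nat \<Rightarrow> edge set" where
  "arcs n t = {((v, t), (v, t + 1)) | v. 1 \<le> v \<and> v \<le> n}"

definition timeline_edges :: "nat \<Rightarrow> edge set" where
  "timeline_edges n = (\<Union>t. horizontal_edges n t \<union> arcs n t)"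

text \<open>Finiteness is demanded because \<^const>\<open>card\<close> of an infinite set is \<open>0\<close>.\<close>

definition feasible :: "nat \<Rightarrow> nat \<Rightarrow> replica list \<Rightarrow> edge set \<Rightarrow> bool" where
  "feasible n v0 rs F \<longleftrightarrow>
     finite F \<and> F \<subseteq> timeline_edges n \<and> (\<forall>r \<in> set rs. ((v0, 0), r) \<in> F\<^sup>*)"

text \<open>On a directed line a replica to the left of the origin cannot be reached at all, so the
  inputs are the time-ordered request sequences that admit some feasible solution.\<close>

definition valid_input :: "nat \<Rightarrow> nat \<Rightarrow> replica list \<Rightarrow> bool" where
  "valid_input n v0 rs \<longleftrightarrow>
     set rs \<subseteq> replicas n \<and> sorted (map snd rs) \<and> (\<exists>F. feasible n v0 rs F)"

definition opt_cost :: "nat \<Rightarrow> nat \<Rightarrow> replica list \<Rightarrow> nat" where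
  "opt_cost n v0 rs = (LEAST k. \<exists>F. feasible n v0 rs F \<and> card F = k)"

text \<open>\<open>Tick t\<close> is the announcement that time \<open>t\<close> has ended.\<close>

datatype event = Request replica | Tick nat

text \<open>The events of an input, starting at time \<open>s\<close>. The input ends with its last request: there
  is no tick after it, so no algorithm is charged for storage beyond the last request.\<close>

fun events :: "nat \<Rightarrow> replica list \<Rightarrow> event list" where
  "events s [] = []"
| "events s (r # rs) = map Tick [s..<snd r] @ Request r # events (snd r) rs"

text \<open>An algorithm knows the network size and the origin, and maps the past events, the current
  event and the current solution to the set of edges it adds.\<close>

type_synonym algorithm =
  "nat \<Rightarrow> nat \<Rightarrow> event list \<Rightarrow> event \<Rightarrow> edge set \<Rightarrow> edge set"

fun allowed :: "nat \<Rightarrow> event \<Rightarrow> edge set" where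
  "allowed n (Request r) = horizontal_edges n (snd r)"
| "allowed n (Tick t) = arcs n t"

definition online_algorithm :: "algorithm \<Rightarrow> bool" where
  "online_algorithm A \<longleftrightarrow> (\<forall>n v0 past e F. A n v0 past e F \<subseteq> allowed n e)"

fun run :: "algorithm \<Rightarrow> nat \<Rightarrow> nat \<Rightarrow> event list \<Rightarrow> edge set \<Rightarrow> event list \<Rightarrow> edge set" where
  "run A n v0 past F [] = F"
| "run A n v0 past F (e # es) = run A n v0 (past @ [e]) (F \<union> A n v0 past e F) es"

definition solution :: "algorithm \<Rightarrow> nat \<Rightarrow> nat \<Rightarrow> replica list \<Rightarrow> edge set" where
  "solution A n v0 rs = run A n v0 [] {} (events 0 rs)"

text \<open>The ratio \<open>\<rho> n N\<close> may depend on the number of nodes and the number of requests, although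
  the algorithm does not know the latter.\<close>

definition competitive :: "algorithm \<Rightarrow> (nat \<Rightarrow> nat \<Rightarrow> real) \<Rightarrow> bool" where
  "competitive A \<rho> \<longleftrightarrow> online_algorithm A \<and>
     (\<forall>n v0 rs. 1 \<le> v0 \<and> v0 \<le> n \<and> valid_input n v0 rs \<longrightarrow>
        feasible n v0 rs (solution A n v0 rs) \<and>
        real (card (solution A n v0 rs)) \<le> \<rho> n (length rs) * real (opt_cost n v0 rs))"

text \<open>\<open>log x / log log x\<close>, replaced by the constant \<open>1\<close> for \<open>x < 3\<close>, where \<open>ln (ln x)\<close> is
  negative or meaningless; the quotient is positive for all \<open>x \<ge> 3\<close>.\<close>

definition log_over_loglog :: "nat \<Rightarrow> real" where
  "log_over_loglog x = (if x < 3 then 1 else ln (real x) / ln (ln (real x)))"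

definition dmcd_ratio :: "nat \<Rightarrow> nat \<Rightarrow> real" where
  "dmcd_ratio n N = min (log_over_loglog N) (log_over_loglog n)"

end

theory Submission imports Defs begin

text \<open>
  Upper bound. A column \<open>w\<close> is available at time \<open>s\<close> if \<open>(w, s)\<close> is already reached; a request is served
  by a horizontal segment from the nearest available column to its left. After a service of length
  \<open>l\<close> with \<open>d ^ i \<le> l < d ^ (i + 1)\<close>, the segment's columns that are multiples of \<open>d ^ j\<close> stay available for
  time \<open>d ^ i\<close> if \<open>j = i\<close>, and \<open>d ^ j div d\<close> for the finer scales that matter; this costs \<open>O(l)\<close>.
  To charge the \<open>l\<close>, take the right half of the segment and extend it back in time by \<open>d ^ i\<close>. Any feasible
  solution crosses this box horizontally, with \<open>l / 2\<close> edges, or vertically, with \<open>d ^ i \<ge> l / d\<close> arcs. Boxes of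
  one level are disjoint, since columns kept at spacing \<open>d ^ i\<close> make later services nearby shorter than
  \<open>d ^ i\<close>. Only \<open>O(d)\<close> levels occur at one edge once services shorter than a fraction \<open>d ^ (- d)\<close> of
  the distance to the origin are dismissed. The factor \<open>d\<close> of vertical crossings is paid at most twice
  per arc: extra columns, kept two cells to the left of the request at every relevant scale, rule it out
  for levels that increase in time. Hence the cost is \<open>O(d)\<close> times the optimum
  whenever \<open>d ^ d\<close> is at least the number of requests or of nodes, and \<open>d\<close> is doubled when needed.

  Lower bound. With \<open>d = L + 1\<close>, a frontier moves one column to the right per time step, and the
  columns at distance \<open>d ^ i\<close> to \<open>d ^ (i + 1)\<close> behind it form level \<open>i < L\<close>. If the algorithm stores no copy in
  level \<open>i\<close> across a step, the adversary requests the column \<open>d ^ i\<close> behind the frontier, which costs the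
  algorithm \<open>d ^ (i + 1) - d ^ i = L * d ^ i\<close>; if it stores copies in all levels it pays \<open>L\<close>. The optimum follows the
  frontier and pays \<open>O(1)\<close> per step plus \<open>d ^ i\<close> per such request, for a ratio of order \<open>L\<close> on an
  instance of size of order \<open>d ^ L\<close>.
\<close>

section \<open>Paths in the time-line graph\<close>

definition hor :: "nat \<times> nat \<Rightarrow> edge" where
  "hor p = (p, (fst p + 1, snd p))"

definition ver :: "nat \<times> nat \<Rightarrow> edge" where
  "ver p = (p, (fst p, snd p + 1))"

lemma inj_hor: "inj hor" and inj_ver: "inj ver"
  by (auto simp: inj_def hor_def ver_def)

lemma hor_neq_ver: "hor p \<noteq> ver q"
  by (cases p; cases q) (auto simp: hor_def ver_def)

lemma horizontal_edges_hor: "horizontal_edges n t = hor ` {(w, t) | w. 1 \<le> w \<and> w + 1 \<le> n}"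
  by (force simp: horizontal_edges_def hor_def)

lemma arcs_ver: "arcs n t = ver ` {(w, t) | w. 1 \<le> w \<and> w \<le> n}"
  by (force simp: arcs_def ver_def)

lemma timeline_edges_cases:
  assumes "(p, q) \<in> F" "F \<subseteq> timeline_edges n"
  obtains "hor p \<in> F" "q = (fst p + 1, snd p)" | "ver p \<in> F" "q = (fst p, snd p + 1)"
proof -
  have "(p, q) \<in> timeline_edges n" using assms by blast
  then consider "(p, q) = hor p" | "(p, q) = ver p"
    by (auto simp: timeline_edges_def horizontal_edges_def arcs_def hor_def ver_def)
  then show thesis using assms(1) that by cases (auto simp: hor_def ver_def)
qed

lemma reach_columns_rows:
  assumes "((v0, 0), p) \<in> F\<^sup>*" "F \<subseteq> timeline_edges n"
  shows "v0 \<le> fst p \<and> (\<forall>w\<in>{v0..<fst p}. \<exists>s\<le>snd p. hor (w, s) \<in> F)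
    \<and> (\<forall>s<snd p. \<exists>w\<in>{v0..fst p}. ver (w, s) \<in> F)"
  using assms(1)
proof (induction rule: rtrancl_induct)
  case (step p q)
  from step.hyps(2) assms(2) show ?case
  proof (cases rule: timeline_edges_cases)
    case 1
    have "\<exists>s\<le>snd q. hor (w, s) \<in> F" if "w \<in> {v0..<fst q}" for w
    proof (cases "w = fst p")
      case True then show ?thesis using 1 by auto
    next
      case False
      then have "w \<in> {v0..<fst p}" using that 1(2) by auto
      then show ?thesis using step.IH 1(2) by auto
    qed
    moreover have "\<exists>w\<in>{v0..fst q}. ver (w, s) \<in> F" if "s < snd q" for s
    proof -
      have "s < snd p" using that 1(2) by simp
      then obtain w where "w \<in> {v0..fst p}" "ver (w, s) \<in> F" using step.IH by blast
      then show ?thesis using 1(2) by (intro bexI[of _ w]) auto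
    qed
    moreover have "v0 \<le> fst q" using step.IH 1(2) by simp
    ultimately show ?thesis by blast
  next
    case 2
    have "\<exists>w\<in>{v0..fst q}. ver (w, s) \<in> F" if "s < snd q" for s
    proof (cases "s = snd p")
      case True then show ?thesis using 2 step.IH by (intro bexI[of _ "fst p"]) auto
    next
      case False
      then have "s < snd p" using that 2(2) by simp
      then show ?thesis using step.IH 2(2) by auto
    qed
    moreover have "\<exists>s\<le>snd q. hor (w, s) \<in> F" if "w \<in> {v0..<fst q}" for w
    proof -
      have "w \<in> {v0..<fst p}" using that 2(2) by simp
      then obtain s where "s \<le> snd p" "hor (w, s) \<in> F" using step.IH by blast
      then show ?thesis using 2(2) by (intro exI[of _ s]) auto
    qed
    moreover have "v0 \<le> fst q" using step.IH 2(2) by simp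
    ultimately show ?thesis by blast
  qed
qed simp

text \<open>A path that ends in the box right of column \<open>b\<close> enters it through its left side or through
  its bottom.\<close>

lemma reach_box_aux:
  assumes "((v0, 0), p) \<in> F\<^sup>*" "F \<subseteq> timeline_edges n"
  shows "v0 \<le> b \<Longrightarrow> b < fst p \<Longrightarrow> s \<le> snd p \<Longrightarrow>
    (\<forall>w\<in>{b..<fst p}. \<exists>r\<in>{s..snd p}. hor (w, r) \<in> F) \<or>
    (\<forall>r\<in>{s..<snd p}. \<exists>w\<in>{b<..fst p}. ver (w, r) \<in> F)"
  using assms(1)
proof (induction rule: rtrancl_induct)
  case (step p q)
  from step.hyps(2) assms(2) show ?case
  proof (cases rule: timeline_edges_cases)
    case 1
    show ?thesis
    proof (cases "b = fst p")
      case True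
      then have "{b..<fst q} = {fst p}" using 1(2) by auto
      moreover have "hor (fst p, snd p) \<in> F" using 1(1) by (metis prod.collapse)
      moreover have "s \<le> snd p" "snd p \<le> snd q"
        using 1 step.prems(3) by auto
      ultimately have "\<forall>w\<in>{b..<fst q}. \<exists>r\<in>{s..snd q}. hor (w, r) \<in> F"
        by (metis atLeastAtMost_iff singletonD)
      then show ?thesis ..
    next
      case False
      then have "b < fst p" "s \<le> snd p" using step.prems 1(2) by auto
      from step.IH[OF step.prems(1) this]
      show ?thesis
      proof
        assume a: "\<forall>w\<in>{b..<fst p}. \<exists>r\<in>{s..snd p}. hor (w, r) \<in> F"
        have "\<exists>r\<in>{s..snd q}. hor (w, r) \<in> F" if "w \<in> {b..<fst q}" for w
        proof (cases "w = fst p")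
          case True then show ?thesis using 1 \<open>s \<le> snd p\<close> by (intro bexI[of _ "snd p"]) auto
        next
          case False
          then have "w \<in> {b..<fst p}" using that 1(2) by auto
          then show ?thesis using a 1(2) by auto
        qed
        then show ?thesis by blast
      next
        assume a: "\<forall>r\<in>{s..<snd p}. \<exists>w\<in>{b<..fst p}. ver (w, r) \<in> F"
        have "\<exists>w\<in>{b<..fst q}. ver (w, r) \<in> F" if "r \<in> {s..<snd q}" for r
        proof -
          have "r \<in> {s..<snd p}" using that 1(2) by simp
          then obtain w where "w \<in> {b<..fst p}" "ver (w, r) \<in> F" using a by blast
          then show ?thesis using 1(2) by (intro bexI[of _ w]) auto
        qed
        then show ?thesis by blast
      qed
    qed
  next
    case 2
    show ?thesis
    proof (cases "s \<le> snd p")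
      case False
      then show ?thesis using 2(2) step.prems by auto
    next
      case True
      have "b < fst p" using step.prems 2(2) by auto
      from step.IH[OF step.prems(1) this True]
      show ?thesis
      proof
        assume a: "\<forall>w\<in>{b..<fst p}. \<exists>r\<in>{s..snd p}. hor (w, r) \<in> F"
        have "\<exists>r\<in>{s..snd q}. hor (w, r) \<in> F" if "w \<in> {b..<fst q}" for w
        proof -
          have "w \<in> {b..<fst p}" using that 2(2) by simp
          then obtain r where "r \<in> {s..snd p}" "hor (w, r) \<in> F" using a by blast
          then show ?thesis using 2(2) by (intro bexI[of _ r]) auto
        qed
        then show ?thesis by blast
      next
        assume a: "\<forall>r\<in>{s..<snd p}. \<exists>w\<in>{b<..fst p}. ver (w, r) \<in> F"
        have "\<exists>w\<in>{b<..fst q}. ver (w, r) \<in> F" if "r \<in> {s..<snd q}" for r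
        proof (cases "r = snd p")
          case True then show ?thesis using 2 \<open>b < fst p\<close> by (intro bexI[of _ "fst p"]) auto
        next
          case False
          then have "r \<in> {s..<snd p}" using that 2(2) by auto
          then show ?thesis using a 2(2) by auto
        qed
        then show ?thesis by blast
      qed
    qed
  qed
qed simp

lemma reach_columns:
  assumes "((v0, 0), (v, t)) \<in> F\<^sup>*" "F \<subseteq> timeline_edges n" "v0 \<le> w" "w < v"
  obtains r where "r \<le> t" "hor (w, r) \<in> F"
proof -
  have "\<forall>w\<in>{v0..<v}. \<exists>r\<le>t. hor (w, r) \<in> F"
    using reach_columns_rows[OF assms(1,2)] unfolding fst_conv snd_conv by (elim conjE)
  moreover have "w \<in> {v0..<v}" using assms(3,4) by simp
  ultimately have "\<exists>r\<le>t. hor (w, r) \<in> F" by (rule bspec)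
  then show thesis using that by (elim exE conjE)
qed

lemma reach_rows:
  assumes "((v0, 0), (v, t)) \<in> F\<^sup>*" "F \<subseteq> timeline_edges n" "r < t"
  obtains w where "ver (w, r) \<in> F"
proof -
  have "\<forall>s<t. \<exists>w\<in>{v0..v}. ver (w, s) \<in> F"
    using reach_columns_rows[OF assms(1,2)] unfolding fst_conv snd_conv by (elim conjE)
  then have "\<exists>w\<in>{v0..v}. ver (w, r) \<in> F" using assms(3) by (elim allE impE)
  then show thesis using that by (elim bexE)
qed

lemma reach_start_le:
  assumes "((v0, 0), (v, t)) \<in> F\<^sup>*" "F \<subseteq> timeline_edges n"
  shows "v0 \<le> v"
  using reach_columns_rows[OF assms] unfolding fst_conv by (elim conjE)

text \<open>The box has height \<open>h\<close>. If it would start before time 0, its bottom cannot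
  be entered and only the horizontal alternative is left; so the vertical one comes with
  \<open>h \<le> t\<close> and yields a full \<open>h\<close> arcs. The form
  \<open>t \<le> r + h\<close> avoids truncated subtraction.\<close>

lemma reach_box:
  assumes "((v0, 0), (v, t)) \<in> F\<^sup>*" "F \<subseteq> timeline_edges n" "v0 \<le> b" "b < v"
  shows "(\<forall>w\<in>{b..<v}. \<exists>r. r \<le> t \<and> t \<le> r + h \<and> hor (w, r) \<in> F) \<or>
    (h \<le> t \<and> (\<forall>r\<in>{t-h..<t}. \<exists>w\<in>{b<..v}. ver (w, r) \<in> F))"
proof (cases "h \<le> t")
  case True
  have "b < fst (v, t)" "t - h \<le> snd (v, t)" using assms(4) by simp_all
  from reach_box_aux[OF assms(1-3) this]
  have "(\<forall>w\<in>{b..<v}. \<exists>r\<in>{t-h..t}. hor (w, r) \<in> F) \<or>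
      (\<forall>r\<in>{t-h..<t}. \<exists>w\<in>{b<..v}. ver (w, r) \<in> F)"
    unfolding fst_conv snd_conv .
  then show ?thesis
  proof
    assume a: "\<forall>w\<in>{b..<v}. \<exists>r\<in>{t-h..t}. hor (w, r) \<in> F"
    show ?thesis
    proof (intro disjI1 ballI)
      fix w assume "w \<in> {b..<v}"
      with a have "\<exists>r\<in>{t-h..t}. hor (w, r) \<in> F" by (rule bspec)
      then obtain r where r: "r \<in> {t-h..t}" "hor (w, r) \<in> F" by (elim bexE)
      have "r \<le> t" "t \<le> r + h" using r(1) by auto
      then show "\<exists>r. r \<le> t \<and> t \<le> r + h \<and> hor (w, r) \<in> F"
        using r(2) by (intro exI conjI)
    qed
  next
    assume "\<forall>r\<in>{t-h..<t}. \<exists>w\<in>{b<..v}. ver (w, r) \<in> F"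
    then show ?thesis using True by (intro disjI2 conjI)
  qed
next
  case False
  show ?thesis
  proof (intro disjI1 ballI)
    fix w assume "w \<in> {b..<v}"
    then have "v0 \<le> w" "w < v" using assms(3) by auto
    then obtain r where "r \<le> t" "hor (w, r) \<in> F" using reach_columns[OF assms(1,2)] by metis
    moreover have "t \<le> r + h" using False by simp
    ultimately show "\<exists>r. r \<le> t \<and> t \<le> r + h \<and> hor (w, r) \<in> F" by (intro exI conjI)
  qed
qed

section \<open>Counting edges of a solution by columns, by rows and by charges\<close>

lemma card_columns_le:
  fixes P :: "(nat \<times> nat) set"
  assumes "finite P" "\<And>w. w \<in> {a..<b} \<Longrightarrow> \<exists>r. (w, r) \<in> P"
  shows "b - a \<le> card P"
proof -
  have "{a..<b} \<subseteq> fst ` P" using assms(2) by force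
  then have "card {a..<b} \<le> card (fst ` P)" using assms(1) by (intro card_mono) auto
  then show ?thesis using card_image_le[OF assms(1), of fst] by simp
qed

lemma card_rows_le:
  fixes P :: "(nat \<times> nat) set"
  assumes "finite P" "\<And>r. r \<in> {a..<b} \<Longrightarrow> \<exists>w. (w, r) \<in> P"
  shows "b - a \<le> card P"
proof -
  have "{a..<b} \<subseteq> snd ` P" using assms(2) by force
  then have "card {a..<b} \<le> card (snd ` P)" using assms(1) by (intro card_mono) auto
  then show ?thesis using card_image_le[OF assms(1), of snd] by simp
qed

definition Hs :: "edge set \<Rightarrow> (nat \<times> nat) set" where "Hs F = {p. hor p \<in> F}"
definition Vs :: "edge set \<Rightarrow> (nat \<times> nat) set" where "Vs F = {p. ver p \<in> F}"

lemma finite_Hs: "finite F \<Longrightarrow> finite (Hs F)"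
  unfolding Hs_def using finite_vimageI[OF _ inj_hor, of F] by (simp add: vimage_def)

lemma finite_Vs: "finite F \<Longrightarrow> finite (Vs F)"
  unfolding Vs_def using finite_vimageI[OF _ inj_ver, of F] by (simp add: vimage_def)

lemma card_Hs_Vs_le:
  assumes "finite F"
  shows "card (Hs F) + card (Vs F) \<le> card F"
proof -
  have "card (hor ` Hs F \<union> ver ` Vs F) = card (hor ` Hs F) + card (ver ` Vs F)"
    using finite_Hs[OF assms, THEN finite_imageI] finite_Vs[OF assms, THEN finite_imageI]
      hor_neq_ver
    by (intro card_Un_disjoint) blast+
  also have "\<dots> = card (Hs F) + card (Vs F)"
    using inj_hor inj_ver by (simp add: card_image inj_on_subset)
  finally have "card (Hs F) + card (Vs F) = card (hor ` Hs F \<union> ver ` Vs F)" by simp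
  also have "\<dots> \<le> card F" using assms by (intro card_mono) (auto simp: Hs_def Vs_def)
  finally show ?thesis .
qed

lemma double_count:
  fixes B :: "'a \<Rightarrow> 'b set"
  assumes "finite K" "finite E" "\<And>k. k \<in> K \<Longrightarrow> B k \<subseteq> E"
    "\<And>e. e \<in> E \<Longrightarrow> card {k \<in> K. e \<in> B k} \<le> m"
  shows "(\<Sum>k\<in>K. card (B k)) \<le> m * card E"
proof -
  have "(\<Sum>k\<in>K. card (B k)) = (\<Sum>k\<in>K. \<Sum>e\<in>E. if e \<in> B k then 1 else 0)"
    using assms(2,3) by (intro sum.cong refl) (auto simp: sum.If_cases Int_absorb1 Int_commute)
  also have "\<dots> = (\<Sum>e\<in>E. \<Sum>k\<in>K. if e \<in> B k then 1 else 0)" by (rule sum.swap)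
  also have "\<dots> = (\<Sum>e\<in>E. card {k \<in> K. e \<in> B k})"
    using assms(1) by (intro sum.cong refl) (auto simp: sum.If_cases Collect_conj_eq)
  also have "\<dots> \<le> (\<Sum>e\<in>E. m)" using assms(4) by (rule sum_mono)
  finally show ?thesis by (simp add: mult.commute)
qed

section \<open>Charging the entries of one phase\<close>

text \<open>Meaningful for \<open>2 \<le> d\<close> and \<open>1 \<le> l\<close> only; otherwise \<open>SOME\<close> may pick an arbitrary number.\<close>

definition level :: "nat \<Rightarrow> nat \<Rightarrow> nat" where
  "level d l = (SOME i. d ^ i \<le> l \<and> l < d ^ (i + 1))"

lemma level:
  assumes "2 \<le> d" "1 \<le> l"
  shows "d ^ level d l \<le> l" "l < d ^ (level d l + 1)"
proof -
  have "\<exists>i. d ^ i \<le> l \<and> l < d ^ (i + 1)" using ex_power_ivl1[OF assms] by blast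
  from someI_ex[OF this] show "d ^ level d l \<le> l" "l < d ^ (level d l + 1)"
    unfolding level_def by blast+
qed

text \<open>The scales from \<open>d ^ (i - d - 2)\<close> on suffice for relevant services (see \<open>descending_time\<close>), and the
  factor \<open>1 / d\<close> makes these \<open>d + 2\<close> scales together as cheap as the scale \<open>i\<close> itself.\<close>

definition hold :: "nat \<Rightarrow> nat \<Rightarrow> nat \<Rightarrow> nat" where
  "hold d i j = (if j = i then d ^ i else if j < i \<and> i \<le> j + d + 2 then d ^ j div d else 0)"

text \<open>The least member \<open>i0\<close> gives \<open>p \<le> d ^ (i0 + m)\<close>, which caps
  all others. With \<open>p\<close> of the order of an edge's distance from the origin, this limits
  the levels that meet at the edge.\<close>

lemma card_levels_le:
  fixes d p m :: nat
  assumes "2 \<le> d" "\<And>i. i \<in> I \<Longrightarrow> d ^ i \<le> p \<and> p \<le> d ^ (i + m)"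
  shows "card I \<le> m + 1" "finite I"
proof -
  have fin: "I \<subseteq> {..p}"
  proof
    fix i assume "i \<in> I"
    have "i < 2 ^ i" by simp
    also have "(2::nat) ^ i \<le> d ^ i" using assms(1) by (rule power_mono) simp
    also have "\<dots> \<le> p" using assms(2) \<open>i \<in> I\<close> by blast
    finally show "i \<in> {..p}" by simp
  qed
  then show fin': "finite I" by (rule finite_subset) simp
  show "card I \<le> m + 1"
  proof (cases "I = {}")
    case False
    define i0 where "i0 = Min I"
    have i0: "i0 \<in> I" using Min_in[OF fin' False] i0_def by simp
    have "I \<subseteq> {i0..i0 + m}"
    proof
      fix i assume i: "i \<in> I"
      have "d ^ i \<le> d ^ (i0 + m)" using assms(2)[OF i] assms(2)[OF i0] by linarith
      then have "i \<le> i0 + m" using assms(1) power_increasing_iff[of d i "i0 + m"] by simp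
      moreover have "i0 \<le> i" using Min_le[OF fin' i] i0_def by simp
      ultimately show "i \<in> {i0..i0 + m}" by simp
    qed
    from card_mono[OF _ this] show ?thesis by simp
  qed simp
qed

lemma card_le_2_if_no_three:
  fixes S :: "nat set"
  assumes "\<And>a b c. a \<in> S \<Longrightarrow> b \<in> S \<Longrightarrow> c \<in> S \<Longrightarrow> a < b \<Longrightarrow> b < c \<Longrightarrow> False"
  shows "card S \<le> 2"
proof (rule ccontr)
  assume "\<not> card S \<le> 2"
  then have "3 \<le> card S" by simp
  then obtain T where T: "T \<subseteq> S" "card T = 3" "finite T"
    using obtain_subset_with_card_n by blast
  define xs where "xs = sorted_list_of_set T"
  have "length xs = 3" "set xs = T" using T by (auto simp: xs_def)
  have "sorted_wrt (<) xs" by (simp add: xs_def)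
  then have "xs ! 0 < xs ! 1" "xs ! 1 < xs ! 2"
    using \<open>length xs = 3\<close> by (simp_all add: sorted_wrt_nth_less)
  moreover have "xs ! 0 \<in> S" "xs ! 1 \<in> S" "xs ! 2 \<in> S"
    using \<open>length xs = 3\<close> \<open>set xs = T\<close> T(1) nth_mem[of _ xs] by force+
  ultimately show False using assms by blast
qed

text \<open>\<open>K\<close> indexes the requests served with base \<open>d\<close>, the \<open>k\<close>-th one from column \<open>u k\<close> to column \<open>v k\<close> at time
  \<open>t k\<close>. That a column \<open>w\<close> is available is expressed by its effect: a later request at or right of \<open>w\<close>
  is not served from the left of \<open>w\<close>.\<close>

locale phase =
  fixes d v0 n :: nat and F :: "edge set" and K :: "nat set" and u v t :: "nat \<Rightarrow> nat"
  assumes d: "2 \<le> d" and finF: "finite F" and F: "F \<subseteq> timeline_edges n" and finK: "finite K"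
    and len: "k \<in> K \<Longrightarrow> v0 \<le> u k \<and> u k < v k"
    and reach: "k \<in> K \<Longrightarrow> ((v0, 0), (v k, t k)) \<in> F\<^sup>*"
    and line: "\<lbrakk>k1 \<in> K; k2 \<in> K; k1 < k2; u k1 \<le> w; w \<le> v k1;
        w = u k1 \<or> w = v k1 \<or> d ^ j dvd w; j \<le> level d (v k1 - u k1);
        t k2 \<le> t k1 + hold d (level d (v k1 - u k1)) j; w \<le> v k2\<rbrakk> \<Longrightarrow> w \<le> u k2"
    and guard: "\<lbrakk>k1 \<in> K; k2 \<in> K; k1 < k2; v k1 - v0 \<le> d ^ j * d ^ (d + 2); t k2 \<le> t k1 + d ^ j\<rbrakk> \<Longrightarrow>
        \<exists>c. d ^ j * (v k1 div d ^ j - 2) \<le> c \<and> c \<le> max (u k1) (d ^ j * (v k1 div d ^ j - 2)) \<and>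
          (c \<le> v k2 \<longrightarrow> c \<le> u k2)"
    and mono: "\<lbrakk>k1 \<in> K; k2 \<in> K; k1 < k2\<rbrakk> \<Longrightarrow> t k1 \<le> t k2"
begin

section \<open>Boxes charged by the services of a phase\<close>

definition lv :: "nat \<Rightarrow> nat" where "lv k = level d (v k - u k)"

definition mid :: "nat \<Rightarrow> nat" where "mid k = u k + (v k - u k) div 2"

text \<open>In the right half, every column is about half the service length or more away from the
  origin, which bounds the levels at one edge from above. The column ranges of \<open>BH\<close> and
  \<open>BV\<close> differ because \<open>hor\<close> ends one column further right, while
  \<open>reach_box\<close> yields arcs strictly right of \<open>mid k\<close>.\<close>

definition BH :: "nat \<Rightarrow> (nat \<times> nat) set" where
  "BH k = {p \<in> Hs F. mid k \<le> fst p \<and> fst p < v k \<and> snd p \<le> t k \<and> t k \<le> snd p + d ^ lv k}"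

definition BV :: "nat \<Rightarrow> (nat \<times> nat) set" where
  "BV k = {p \<in> Vs F. mid k < fst p \<and> fst p \<le> v k \<and> snd p < t k \<and> t k \<le> snd p + d ^ lv k}"

lemma lv: assumes "k \<in> K" shows "d ^ lv k \<le> v k - u k" "v k - u k < d * d ^ lv k"
  using level[OF d, of "v k - u k"] len[OF assms] by (auto simp: lv_def)

lemma d_pow_pos: "0 < d ^ j" using d by simp

lemma mid: assumes "k \<in> K"
  shows "v0 \<le> mid k" "mid k < v k" "v k - u k \<le> 2 * (v k - mid k)" "u k \<le> mid k"
    "u k + v k \<le> 2 * mid k + 1"
  using len[OF assms] by (auto simp: mid_def)

text \<open>A horizontal crossing has at least half the length. A vertical one may have only
  \<open>d ^ lv k\<close> arcs against a length just below \<open>d * d ^ lv k\<close>; the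
  threshold 6 is the one that \<open>ascending_cheap\<close> delivers.\<close>

lemma length_le_boxes:
  assumes k: "k \<in> K"
  shows "v k - u k \<le> 2 * card (BH k) + (if v k - u k < 6 * d ^ lv k then 6 else d) * card (BV k)"
proof -
  have fin: "finite (BH k)" "finite (BV k)"
    using finite_Hs[OF finF] finite_Vs[OF finF] by (simp_all add: BH_def BV_def)
  from reach_box[OF reach[OF k] F mid(1,2)[OF k], of "d ^ lv k"] show ?thesis
  proof
    assume a: "\<forall>w\<in>{mid k..<v k}. \<exists>r\<le>t k. t k \<le> r + d ^ lv k \<and> hor (w, r) \<in> F"
    have "v k - mid k \<le> card (BH k)"
    proof (rule card_columns_le[OF fin(1)])
      fix w assume w: "w \<in> {mid k..<v k}"
      with a have "\<exists>r\<le>t k. t k \<le> r + d ^ lv k \<and> hor (w, r) \<in> F" by (rule bspec)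
      then show "\<exists>r. (w, r) \<in> BH k" using w unfolding BH_def Hs_def by auto
    qed
    then show ?thesis using mid(3)[OF k] by linarith
  next
    assume a: "d ^ lv k \<le> t k \<and> (\<forall>r\<in>{t k - d ^ lv k..<t k}. \<exists>w\<in>{mid k<..v k}. ver (w, r) \<in> F)"
    have "t k - (t k - d ^ lv k) \<le> card (BV k)"
    proof (rule card_rows_le[OF fin(2)])
      fix r assume r: "r \<in> {t k - d ^ lv k..<t k}"
      have "\<exists>w\<in>{mid k<..v k}. ver (w, r) \<in> F" using conjunct2[OF a] r by (rule bspec)
      then show "\<exists>w. (w, r) \<in> BV k" using r unfolding BV_def Vs_def by auto
    qed
    then have x: "d ^ lv k \<le> card (BV k)" using a by simp
    show ?thesis
    proof (cases "v k - u k < 6 * d ^ lv k")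
      case True then show ?thesis using x by simp
    next
      case False
      have "v k - u k \<le> d * card (BV k)"
        using lv(2)[OF k] mult_le_mono2[OF x, of d] by linarith
      then show ?thesis using False by simp
    qed
  qed
qed

text \<open>The last multiple of \<open>d ^ j\<close> before \<open>v k2\<close> was kept, unless it lies left of \<open>u k1\<close>, and \<open>u k1\<close> was
  kept.\<close>

lemma served_from_line:
  assumes k: "k1 \<in> K" "k2 \<in> K" "k1 < k2" "j \<le> lv k1" "t k2 \<le> t k1 + hold d (lv k1) j"
    and w: "u k1 \<le> w" "w \<le> v k2" and no: "\<not> v k1 \<le> u k2"
  shows "v k2 - u k2 < d ^ j"
proof -
  note ln = line[OF k(1-3) _ _ _ k(4)[unfolded lv_def] k(5)[unfolded lv_def]]
  have v: "v k2 < v k1"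
  proof (rule ccontr)
    assume "\<not> v k2 < v k1"
    then have "v k1 \<le> u k2" using ln[of "v k1"] len[OF k(1)] by simp
    with no show False ..
  qed
  define m where "m = d ^ j * (v k2 div d ^ j)"
  have m: "m \<le> v k2" "v k2 < m + d ^ j"
    using times_div_less_eq_dividend[of "d ^ j" "v k2"] dividend_less_times_div[OF d_pow_pos[of j], of "v k2"]
    by (simp_all add: m_def)
  show ?thesis
  proof (cases "u k1 \<le> m")
    case True
    have "m \<le> v k1" "d ^ j dvd m" using m v by (linarith, simp add: m_def)
    then have "m \<le> u k2" using ln[OF True] m(1) by blast
    then show ?thesis using m by linarith
  next
    case False
    have "u k1 \<le> u k2" by (rule ln) (use w len[OF k(1)] in auto)
    then show ?thesis using m False by linarith
  qed
qed

text \<open>Boxes of one level that share an edge are at most their common height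
  \<open>d ^ lv k1\<close> apart in time, which is how long the coarsest line of the earlier service
  is held. So the later service would be too short for its own level.\<close>

lemma same_level_BH:
  assumes "k1 \<in> K" "k2 \<in> K" "k1 < k2" "lv k1 = lv k2" "p \<in> BH k1" "p \<in> BH k2"
  shows False
proof -
  have "t k2 \<le> t k1 + hold d (lv k1) (lv k1)"
    using assms by (auto simp: BH_def hold_def)
  moreover have "u k1 \<le> fst p" "fst p \<le> v k2" "\<not> v k1 \<le> u k2"
    using assms mid[of k1] mid[of k2] by (auto simp: BH_def)
  ultimately have "v k2 - u k2 < d ^ lv k1"
    using served_from_line[OF assms(1-3), of "lv k1" "fst p"] by simp
  then show False using lv(1)[OF assms(2)] assms(4) by simp
qed

lemma BV_D:
  assumes "p \<in> BV k" "k \<in> K"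
  shows "u k < fst p" "mid k < fst p" "fst p \<le> v k" "snd p < t k" "t k \<le> snd p + d ^ lv k"
  using assms mid[of k] by (auto simp: BV_def)

lemma not_right_BV:
  assumes "k1 \<in> K" "k2 \<in> K" "p \<in> BV k1" "p \<in> BV k2"
  shows "\<not> v k1 \<le> u k2"
  using BV_D[OF assms(3,1)] BV_D[OF assms(4,2)] by linarith

lemma same_level_BV:
  assumes "k1 \<in> K" "k2 \<in> K" "k1 < k2" "lv k1 = lv k2" "p \<in> BV k1" "p \<in> BV k2"
  shows False
proof -
  note D = BV_D[OF assms(5,1)] BV_D[OF assms(6,2)]
  have "t k2 \<le> t k1 + hold d (lv k1) (lv k1)"
    using D assms(4) by (simp add: hold_def)
  then have "v k2 - u k2 < d ^ lv k1"
    using served_from_line[OF assms(1-3), of "lv k1" "fst p"] not_right_BV[OF assms(1,2,5,6)] D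
    by simp
  then show False using lv(1)[OF assms(2)] assms(4) by simp
qed

text \<open>The other services total at most \<open>card F\<close> by the choice of \<open>d\<close>.\<close>

definition relevant :: "nat set" where
  "relevant = {k \<in> K. v k - v0 \<le> (v k - u k) * d ^ d}"

text \<open>Passing from the length to the level loses one factor \<open>d\<close>, the factor 2 at
  most another. The 2 compensates for boxes being right halves.\<close>

lemma relevant_level:
  assumes "k \<in> relevant" shows "2 * (v k - v0) \<le> d ^ (lv k + (d + 2))"
proof -
  have k: "k \<in> K" using assms by (simp add: relevant_def)
  have "2 * (v k - v0) \<le> d * ((v k - u k) * d ^ d)"
    using assms d by (intro mult_le_mono) (auto simp: relevant_def)
  also have "\<dots> \<le> d * ((d * d ^ lv k) * d ^ d)"
    using lv(2)[OF k] by (intro mult_le_mono) auto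
  also have "\<dots> = d ^ (lv k + (d + 2))" by (simp add: power_add algebra_simps)
  finally show ?thesis .
qed

text \<open>The guard of \<open>k1\<close> at the scale \<open>j\<close> of the later, longer
  service is still alive when \<open>k2\<close> arrives, and lies less than \<open>3 * d ^ j\<close>
  left of \<open>v k1\<close>: two cells plus rounding. The shared arc lies between the midpoint of
  \<open>k2\<close> and \<open>v k1\<close>, so half the length of \<open>k2\<close> is below
  \<open>3 * d ^ j\<close>.\<close>

lemma ascending_cheap:
  assumes "k1 \<in> K" "k2 \<in> relevant" "k1 < k2" "lv k1 < lv k2" "p \<in> BV k1" "p \<in> BV k2"
  shows "v k2 - u k2 < 6 * d ^ lv k2"
proof -
  have k2: "k2 \<in> K" using assms(2) by (simp add: relevant_def)
  note D = BV_D[OF assms(5,1)] BV_D[OF assms(6) k2]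
  define j q where "j = lv k2" and "q = v k1 div d ^ j"
  have "v k1 - v0 \<le> 2 * (v k2 - v0)"
    using D mid(5)[OF assms(1)] len[OF assms(1)] by linarith
  also have "\<dots> \<le> d ^ j * d ^ (d + 2)"
    using relevant_level[OF assms(2)] by (simp add: j_def power_add algebra_simps)
  finally have "v k1 - v0 \<le> d ^ j * d ^ (d + 2)" .
  moreover have "t k2 \<le> t k1 + d ^ j" using D by (simp add: j_def)
  ultimately have "\<exists>c. d ^ j * (q - 2) \<le> c \<and> c \<le> max (u k1) (d ^ j * (q - 2)) \<and>
      (c \<le> v k2 \<longrightarrow> c \<le> u k2)"
    unfolding q_def by (rule guard[OF assms(1) k2 assms(3)])
  then obtain c where c: "d ^ j * (q - 2) \<le> c" "c \<le> max (u k1) (d ^ j * (q - 2))"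
    "c \<le> v k2 \<longrightarrow> c \<le> u k2"
    by (elim exE conjE)
  have q2: "d ^ j * (q - 2) = d ^ j * q - 2 * d ^ j"
    by (simp only: diff_mult_distrib2 mult.commute[of "d ^ j" 2])
  have q: "d ^ j * q \<le> v k1" "v k1 < d ^ j * q + d ^ j"
    using times_div_less_eq_dividend[of "d ^ j" "v k1"] dividend_less_times_div[OF d_pow_pos[of j], of "v k1"]
    by (simp_all add: q_def)
  have short: "v k1 - u k1 < d ^ j"
  proof -
    have "v k1 - u k1 < d ^ Suc (lv k1)" using lv(2)[OF assms(1)] by simp
    also have "\<dots> \<le> d ^ j" using assms(4) d unfolding j_def by (intro power_increasing) auto
    finally show ?thesis .
  qed
  \<comment> \<open>An available column bounds \<open>u k2\<close> only if it is not right of the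
    request. As \<open>k1\<close> is shorter than \<open>d ^ j\<close>, either bound on
    \<open>c\<close> places it left of the shared arc.\<close>
  have "c \<le> v k2"
  proof (cases "c \<le> u k1")
    case True then show ?thesis using D by linarith
  next
    case False
    then have "c \<le> d ^ j * q - 2 * d ^ j" using c(2) unfolding q2 by linarith
    then have "c \<le> v k1 - 2 * d ^ j" using q(1) by linarith
    moreover have "v k1 < u k1 + d ^ j" using short by linarith
    ultimately show ?thesis using D(1) D(8) by linarith
  qed
  then have "d ^ j * (q - 2) \<le> u k2" using c(1,3) by linarith
  then have "d ^ j * q - 2 * d ^ j \<le> u k2" unfolding q2 .
  then have "v k1 < u k2 + 3 * d ^ j" using q by linarith
  moreover have "u k2 + (v k2 - u k2) div 2 < v k1" using D(3) D(7) unfolding mid_def by linarith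
  ultimately have "(v k2 - u k2) div 2 < 3 * d ^ j" by linarith
  then show ?thesis unfolding j_def by linarith
qed

text \<open>Otherwise the line that \<open>k1\<close> keeps at the finer spacing
  \<open>d ^ lv k2\<close> would still be held and make \<open>k2\<close> too short for its level.
  Relevance of \<open>k2\<close> puts \<open>lv k1\<close> less than \<open>d + 2\<close> levels
  higher, within the range in which \<open>hold\<close> keeps finer lines.\<close>

lemma descending_time:
  assumes "k1 \<in> K" "k2 \<in> relevant" "k1 < k2" "lv k2 < lv k1" "p \<in> BV k1" "p \<in> BV k2"
  shows "t k1 + d ^ lv k2 div d < t k2"
proof (rule ccontr)
  assume n: "\<not> ?thesis"
  have k2: "k2 \<in> K" using assms(2) by (simp add: relevant_def)
  note D = BV_D[OF assms(5,1)] BV_D[OF assms(6) k2]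
  have "d ^ lv k1 \<le> v k1 - u k1" by (rule lv(1)[OF assms(1)])
  also have "\<dots> < 2 * (v k2 - v0)"
    using D mid(5)[OF assms(1)] len[OF assms(1)] by linarith
  also have "\<dots> \<le> d ^ (lv k2 + (d + 2))" by (rule relevant_level[OF assms(2)])
  finally have "d ^ lv k1 < d ^ (lv k2 + (d + 2))" .
  moreover have "1 < d" using d by linarith
  ultimately have "lv k1 < lv k2 + (d + 2)" by (metis power_less_imp_less_exp)
  then have "t k2 \<le> t k1 + hold d (lv k1) (lv k2)" using n assms(4) by (simp add: hold_def)
  then have "v k2 - u k2 < d ^ lv k2"
    using served_from_line[OF assms(1) k2 assms(3), of "lv k2" "fst p"] D assms(4)
      not_right_BV[OF assms(1) k2 assms(5,6)] by simp
  then show False using lv(1)[OF k2] by simp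
qed

lemma inj_lv:
  assumes "\<And>k1 k2. k1 \<in> S \<Longrightarrow> k2 \<in> S \<Longrightarrow> k1 < k2 \<Longrightarrow> lv k1 = lv k2 \<Longrightarrow> False"
  shows "inj_on lv S"
proof (rule inj_onI, rule ccontr)
  fix a b assume "a \<in> S" "b \<in> S" "lv a = lv b" "a \<noteq> b"
  moreover from \<open>a \<noteq> b\<close> have "a < b \<or> b < a" by linarith
  ultimately show False using assms[of a b] assms[of b a] by (elim disjE) metis+
qed

text \<open>Boxes at one edge have distinct levels, and relevance confines these to
  \<open>d + 3\<close> consecutive values determined by the distance of the edge from the
  origin.\<close>

lemma card_BH_le: "card {k \<in> relevant. p \<in> BH k} \<le> d + 3"
proof -
  let ?S = "{k \<in> relevant. p \<in> BH k}"
  have K: "k \<in> K" if "k \<in> ?S" for k using that by (simp add: relevant_def)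
  have "inj_on lv ?S" using same_level_BH K by (intro inj_lv) blast
  then have "card ?S = card (lv ` ?S)" by (simp add: card_image)
  also have "\<dots> \<le> (d + 2) + 1"
  proof (rule card_levels_le(1)[OF d, where p = "2 * (fst p + 1 - v0)"])
    fix i assume "i \<in> lv ` ?S"
    then obtain k where k: "k \<in> ?S" "i = lv k" by blast
    have b: "mid k \<le> fst p" "fst p < v k" using k(1) by (auto simp: BH_def)
    have "d ^ lv k \<le> 2 * (fst p + 1 - v0)"
      using lv(1)[OF K[OF k(1)]] mid(5)[OF K[OF k(1)]] len[OF K[OF k(1)]] b by linarith
    moreover have "2 * (fst p + 1 - v0) \<le> d ^ (lv k + (d + 2))"
      using relevant_level[of k] k(1) b by simp
    ultimately show "d ^ i \<le> 2 * (fst p + 1 - v0) \<and> 2 * (fst p + 1 - v0) \<le> d ^ (i + (d + 2))"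
      using k(2) by simp
  qed
  finally show ?thesis by simp
qed

lemma card_BV_le: "card {k \<in> relevant. p \<in> BV k} \<le> d + 3"
proof -
  let ?S = "{k \<in> relevant. p \<in> BV k}"
  have K: "k \<in> K" if "k \<in> ?S" for k using that by (simp add: relevant_def)
  have "inj_on lv ?S" using same_level_BV K by (intro inj_lv) blast
  then have "card ?S = card (lv ` ?S)" by (simp add: card_image)
  also have "\<dots> \<le> (d + 2) + 1"
  proof (rule card_levels_le(1)[OF d, where p = "2 * (fst p - v0)"])
    fix i assume "i \<in> lv ` ?S"
    then obtain k where k: "k \<in> ?S" "i = lv k" by blast
    have b: "mid k < fst p" "fst p \<le> v k" using k(1) by (auto simp: BV_def)
    have "d ^ lv k \<le> 2 * (fst p - v0)"
      using lv(1)[OF K[OF k(1)]] mid(5)[OF K[OF k(1)]] len[OF K[OF k(1)]] b by linarith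
    moreover have "2 * (fst p - v0) \<le> d ^ (lv k + (d + 2))"
      using relevant_level[of k] k(1) b by simp
    ultimately show "d ^ i \<le> 2 * (fst p - v0) \<and> 2 * (fst p - v0) \<le> d ^ (i + (d + 2))"
      using k(2) by simp
  qed
  finally show ?thesis by simp
qed

definition expensive :: "nat set" where
  "expensive = {k \<in> relevant. 6 * d ^ lv k \<le> v k - u k}"

text \<open>At a fixed arc, the levels of expensive boxes strictly decrease in time. Of three, the
  second request comes more than \<open>d ^ (lv k2 - 1) \<ge> d ^ lv k3\<close> after the first, and
  the third is not earlier; so the third box, of height \<open>d ^ lv k3\<close>, cannot reach down
  to an arc that starts before \<open>t k1\<close>.\<close>

lemma card_expensive_le: "card {k \<in> expensive. p \<in> BV k} \<le> 2"
proof (rule card_le_2_if_no_three)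
  fix k1 k2 k3
  assume "k1 \<in> {k \<in> expensive. p \<in> BV k}" "k2 \<in> {k \<in> expensive. p \<in> BV k}"
    "k3 \<in> {k \<in> expensive. p \<in> BV k}" and less: "k1 < k2" "k2 < k3"
  then have r: "k1 \<in> relevant" "k2 \<in> relevant" "k3 \<in> relevant"
    and e: "6 * d ^ lv k2 \<le> v k2 - u k2" "6 * d ^ lv k3 \<le> v k3 - u k3"
    and p: "p \<in> BV k1" "p \<in> BV k2" "p \<in> BV k3"
    by (auto simp: expensive_def)
  have K: "k1 \<in> K" "k2 \<in> K" "k3 \<in> K" using r by (auto simp: relevant_def)
  have 12: "lv k2 < lv k1"
    using ascending_cheap[OF K(1) r(2) less(1) _ p(1,2)] e(1) same_level_BV[OF K(1,2) less(1) _ p(1,2)]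
    by (cases "lv k1" "lv k2" rule: linorder_cases) auto
  have 23: "lv k3 < lv k2"
    using ascending_cheap[OF K(2) r(3) less(2) _ p(2,3)] e(2) same_level_BV[OF K(2,3) less(2) _ p(2,3)]
    by (cases "lv k2" "lv k3" rule: linorder_cases) auto
  have "d ^ lv k3 \<le> d ^ (lv k2 - 1)" using 23 d by (intro power_increasing) auto
  also have "\<dots> = d ^ lv k2 div d" using 23 d by (cases "lv k2") auto
  finally have "t k1 + d ^ lv k3 < t k2"
    using descending_time[OF K(1) r(2) less(1) 12 p(1,2)] by linarith
  then show False
    using mono[OF K(2,3) less(2)] BV_D[OF p(1) K(1)] BV_D[OF p(3) K(3)] by linarith
qed

lemma sum_relevant: "(\<Sum>k\<in>relevant. v k - u k) \<le> (8 * d + 18) * card F"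
proof -
  have fin: "finite relevant" "finite expensive"
    using finK by (simp_all add: relevant_def expensive_def)
  have sub: "expensive \<subseteq> relevant" by (auto simp: expensive_def)
  note finH = finite_Hs[OF finF] and finV = finite_Vs[OF finF]
  have H: "(\<Sum>k\<in>relevant. card (BH k)) \<le> (d + 3) * card (Hs F)"
    by (rule double_count[OF fin(1) finH _ card_BH_le]) (auto simp: BH_def)
  have V: "(\<Sum>k\<in>relevant. card (BV k)) \<le> (d + 3) * card (Vs F)"
    by (rule double_count[OF fin(1) finV _ card_BV_le]) (auto simp: BV_def)
  have E: "(\<Sum>k\<in>expensive. card (BV k)) \<le> 2 * card (Vs F)"
    by (rule double_count[OF fin(2) finV _ card_expensive_le]) (auto simp: BV_def)
  have "(\<Sum>k\<in>relevant. v k - u k) \<le>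
      (\<Sum>k\<in>relevant. 2 * card (BH k) + 6 * card (BV k) + (if k \<in> expensive then d * card (BV k) else 0))"
  proof (rule sum_mono)
    fix k assume k: "k \<in> relevant"
    then have "k \<in> K" by (simp add: relevant_def)
    from length_le_boxes[OF this] k
    show "v k - u k \<le> 2 * card (BH k) + 6 * card (BV k) + (if k \<in> expensive then d * card (BV k) else 0)"
      by (auto simp: expensive_def split: if_splits)
  qed
  also have "\<dots> = 2 * (\<Sum>k\<in>relevant. card (BH k)) + 6 * (\<Sum>k\<in>relevant. card (BV k))
      + d * (\<Sum>k\<in>expensive. card (BV k))"
    using fin sub by (simp add: sum.distrib sum_distrib_left sum.If_cases Int_absorb1)
  also have "\<dots> \<le> 2 * ((d + 3) * card (Hs F)) + 6 * ((d + 3) * card (Vs F)) + d * (2 * card (Vs F))"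
    using H V E by (intro add_mono mult_le_mono2) auto
  \<comment> \<open>An arc is charged 6 times by each of \<open>d + 3\<close> boxes and
    \<open>d\<close> times by at most two expensive ones:
    \<open>6 * (d + 3) + 2 * d = 8 * d + 18\<close>.\<close>
  also have "\<dots> \<le> (8 * d + 18) * (card (Hs F) + card (Vs F))"
    by (simp add: algebra_simps)
  also have "\<dots> \<le> (8 * d + 18) * card F"
    using card_Hs_Vs_le[OF finF] by (rule mult_le_mono2)
  finally show ?thesis .
qed

lemma width_le: assumes "k \<in> K" shows "v k - v0 \<le> card F"
proof -
  have "v k - v0 \<le> card (Hs F)"
  proof (rule card_columns_le[OF finite_Hs[OF finF]])
    fix w assume "w \<in> {v0..<v k}"
    then have "v0 \<le> w" "w < v k" by auto
    then obtain r where "hor (w, r) \<in> F" using reach_columns[OF reach[OF assms] F] by metis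
    then show "\<exists>r. (w, r) \<in> Hs F" by (auto simp: Hs_def)
  qed
  then show ?thesis using card_Hs_Vs_le[OF finF] by linarith
qed

text \<open>An irrelevant service is shorter than \<open>card F / d ^ d\<close>, as any solution
  covers the columns from the origin to \<open>v k\<close>; so \<open>d ^ d\<close> of them total at
  most \<open>card F\<close>. If all distances are at most \<open>d ^ d\<close>, every service is
  relevant.\<close>

lemma sum_length:
  assumes "card K \<le> d ^ d \<or> (\<forall>k\<in>K. v k - v0 \<le> d ^ d)"
  shows "(\<Sum>k\<in>K. v k - u k) \<le> 18 * d * card F"
proof -
  have "(\<Sum>k\<in>K - relevant. v k - u k) \<le> card F"
    using assms
  proof
    assume a: "\<forall>k\<in>K. v k - v0 \<le> d ^ d"
    have "k \<in> relevant" if "k \<in> K" for k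
    proof -
      have "v k - v0 \<le> 1 * d ^ d" using a that by simp
      also have "\<dots> \<le> (v k - u k) * d ^ d" using len[OF that] by (intro mult_le_mono1) linarith
      finally have "v k - v0 \<le> (v k - u k) * d ^ d" .
      then show ?thesis using that by (simp add: relevant_def)
    qed
    then have e: "K - relevant = {}" by blast
    show ?thesis unfolding e by simp
  next
    assume a: "card K \<le> d ^ d"
    have "(\<Sum>k\<in>K - relevant. v k - u k) * d ^ d = (\<Sum>k\<in>K - relevant. (v k - u k) * d ^ d)"
      by (rule sum_distrib_right)
    also have "\<dots> \<le> (\<Sum>k\<in>K - relevant. card F)"
    proof (rule sum_mono)
      fix k assume "k \<in> K - relevant"
      then show "(v k - u k) * d ^ d \<le> card F" using width_le[of k] by (auto simp: relevant_def)
    qed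
    also have "\<dots> = card (K - relevant) * card F" by simp
    also have "\<dots> \<le> d ^ d * card F"
      using a card_mono[OF finK, of "K - relevant"] by (intro mult_le_mono1) auto
    finally have "(\<Sum>k\<in>K - relevant. v k - u k) * d ^ d \<le> card F * d ^ d"
      by (simp only: mult.commute)
    then show ?thesis using d_pow_pos[of d] by (metis mult_le_cancel2)
  qed
  moreover have "(\<Sum>k\<in>K. v k - u k) = (\<Sum>k\<in>K - relevant. v k - u k) + (\<Sum>k\<in>relevant. v k - u k)"
    by (rule sum.subset_diff[OF _ finK]) (auto simp: relevant_def)
  ultimately have "(\<Sum>k\<in>K. v k - u k) \<le> (8 * d + 18) * card F + card F"
    using sum_relevant by linarith
  also have "\<dots> = (8 * d + 19) * card F" by (simp add: algebra_simps)
  also have "\<dots> \<le> 18 * d * card F" using d by (intro mult_le_mono1) simp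
  finally show ?thesis .
qed

section \<open>The number of active guards\<close>

definition guarded :: "nat \<Rightarrow> nat \<Rightarrow> bool" where
  "guarded k j \<longleftrightarrow> v0 < d ^ j * (v k div d ^ j - 2) \<and> v k - v0 \<le> d ^ j * d ^ (d + 2)"

text \<open>A guard is identified by scale and cell, so requests of one cell count once. What
  \<open>guarded\<close> leaves out is free: if \<open>d ^ j * (q - 2) \<le> v0\<close> the origin
  acts as guard, and scales too fine for the distance concern no relevant service.\<close>

definition guards :: "nat \<Rightarrow> (nat \<times> nat) set" where
  "guards s = {(j, q). \<exists>k\<in>K. t k \<le> s \<and> s < t k + d ^ j \<and> v k div d ^ j = q \<and> guarded k j}"

text \<open>Time is cut into slices of length \<open>d ^ j\<close> as well, so that the activity of level \<open>j\<close> is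
  measured by grid cells.\<close>

definition cells :: "(nat \<times> nat \<times> nat) set" where
  "cells = (\<lambda>(k, j). (j, v k div d ^ j, t k div d ^ j)) ` {(k, j). k \<in> K \<and> guarded k j}"

text \<open>Two column cells and two time slices: they contain the box of height
  \<open>d ^ j\<close> from column \<open>d ^ j * (q - 1)\<close> to a request of the cell.\<close>

definition near :: "nat \<times> nat \<times> nat \<Rightarrow> (nat \<times> nat) set" where
  "near = (\<lambda>(j, q, m). {p. q \<le> fst p div d ^ j + 1 \<and> fst p div d ^ j \<le> q \<and>
      m \<le> snd p div d ^ j + 1 \<and> snd p div d ^ j \<le> m})"

lemma finite_cells: "finite cells"
proof -
  have "{(k, j). k \<in> K \<and> guarded k j} \<subseteq> (\<Union>k\<in>K. {k} \<times> {..v k})"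
  proof clarify
    fix k j assume k: "k \<in> K" and g: "guarded k j"
    have "v k div d ^ j \<noteq> 0" using g by (intro notI) (simp add: guarded_def)
    then have "d ^ j \<le> v k" by (metis div_eq_0_iff not_le_imp_less)
    moreover have "j < 2 ^ j" "(2::nat) ^ j \<le> d ^ j" using d by (simp_all add: power_mono)
    ultimately have "j \<le> v k" by linarith
    then show "(k, j) \<in> (\<Union>k\<in>K. {k} \<times> {..v k})" using k by blast
  qed
  then have "finite {(k, j). k \<in> K \<and> guarded k j}"
    by (rule finite_subset) (simp add: finK)
  then show ?thesis unfolding cells_def by (rule finite_imageI)
qed

text \<open>\<open>guarded\<close> puts the origin more than a full cell left of the cells in
  \<open>near\<close>, hence the lower bound. As with the boxes, this confines the scales at one
  edge.\<close>

lemma near_range: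
  assumes "(j, q, m) \<in> cells" "p \<in> near (j, q, m)"
  shows "d ^ j \<le> fst p - v0 \<and> fst p - v0 \<le> d ^ (j + (d + 3))"
proof -
  define x where "x = d ^ j"
  have x: "0 < x" using d_pow_pos by (simp add: x_def)
  obtain k where g: "v0 < x * (q - 2)" "v k - v0 \<le> x * d ^ (d + 2)" "q = v k div x"
    using assms(1) by (auto simp: cells_def guarded_def x_def)
  have c: "q \<le> fst p div x + 1" "fst p div x \<le> q" using assms(2) by (auto simp: near_def x_def)
  have "q - 2 \<noteq> 0" using g(1) by (intro notI) simp
  have "x * (q - 2) + x \<le> x * (fst p div x)"
    using c(1) \<open>q - 2 \<noteq> 0\<close> mult_le_mono2[of "q - 2 + 1" "fst p div x" x] by (simp add: algebra_simps)
  moreover have "x * (fst p div x) \<le> fst p" by simp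
  ultimately have low: "x \<le> fst p - v0" using g(1) by linarith
  have "fst p < x * (fst p div x) + x" using dividend_less_times_div[OF x, of "fst p"] by simp
  moreover have "x * (fst p div x) \<le> x * q" using c(2) by (rule mult_le_mono2)
  moreover have "x * q \<le> v k" by (simp add: g(3))
  ultimately have "fst p - v0 \<le> (v k - v0) + x" by linarith
  also have "\<dots> \<le> x * d ^ (d + 2) + x * d ^ (d + 2)"
    using g(2) d_pow_pos[of "d + 2"] by (intro add_mono) simp_all
  also have "\<dots> = 2 * (x * d ^ (d + 2))" by simp
  also have "\<dots> \<le> d * (x * d ^ (d + 2))" using d by (rule mult_le_mono1)
  also have "\<dots> = d ^ (j + (d + 3))" by (simp add: x_def power_add algebra_simps eval_nat_numeral)
  finally show ?thesis using low by (simp add: x_def)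
qed

lemma card_near_cells: "card {z \<in> cells. p \<in> near z} \<le> 4 * (d + 4)"
proof -
  define J where "J = {j. d ^ j \<le> fst p - v0 \<and> fst p - v0 \<le> d ^ (j + (d + 3))}"
  have J: "card J \<le> d + 3 + 1" "finite J"
    using card_levels_le[OF d, of J "fst p - v0" "d + 3"] by (auto simp: J_def)
  let ?f = "\<lambda>(j, a, b). (j, fst p div d ^ j + a, snd p div d ^ j + b)"
  let ?D = "J \<times> ({0, 1} :: nat set) \<times> ({0, 1} :: nat set)"
  have "{z \<in> cells. p \<in> near z} \<subseteq> ?f ` ?D"
  proof clarify
    fix j q m assume z: "(j, q, m) \<in> cells" "p \<in> near (j, q, m)"
    define a b where "a = q - fst p div d ^ j" and "b = m - snd p div d ^ j"
    have "a \<le> 1" "b \<le> 1" "q = fst p div d ^ j + a" "m = snd p div d ^ j + b"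
      using z(2) by (auto simp: near_def a_def b_def)
    moreover from \<open>a \<le> 1\<close> \<open>b \<le> 1\<close> have "a \<in> {0, 1}" "b \<in> {0, 1}" by auto
    moreover have "j \<in> J" using near_range[OF z] by (simp add: J_def)
    ultimately show "(j, q, m) \<in> ?f ` ?D"
      by (intro image_eqI[of _ _ "(j, a, b)"]) (simp, intro SigmaI)
  qed
  then have "card {z \<in> cells. p \<in> near z} \<le> card (?f ` ?D)" using J(2) by (intro card_mono) simp_all
  also have "\<dots> \<le> card ?D" using J(2) by (intro card_image_le) simp
  also have "\<dots> \<le> 4 * (d + 4)" using J(1) by (simp add: card_cartesian_product)
  finally show ?thesis .
qed

text \<open>The box begins one cell left of \<open>q\<close>, so it is at least \<open>d ^ j\<close>
  wide wherever \<open>v k\<close> lies in its cell; crossing it either way takes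
  \<open>d ^ j\<close> edges.\<close>

lemma cell_cost:
  assumes "(j, q, m) \<in> cells"
  shows "d ^ j \<le> card (Hs F \<inter> near (j, q, m)) + card (Vs F \<inter> near (j, q, m))"
proof -
  define x where "x = d ^ j"
  have x: "0 < x" using d_pow_pos by (simp add: x_def)
  obtain k where k: "k \<in> K" "v0 < x * (q - 2)" "q = v k div x" "m = t k div x"
    using assms by (auto simp: cells_def guarded_def x_def)
  have "q - 2 \<noteq> 0" using k(2) by (intro notI) simp
  define b where "b = x * (q - 1)"
  have b: "b + x \<le> v k"
  proof -
    have "b + x = x * (q - 1 + 1)" by (simp only: b_def distrib_left mult_1_right)
    also have "q - 1 + 1 = q" using \<open>q - 2 \<noteq> 0\<close> by simp
    finally show ?thesis by (simp add: k(3))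
  qed
  have "v0 \<le> b"
  proof -
    have "x * (q - 2) \<le> b" unfolding b_def by (rule mult_le_mono2) linarith
    then show ?thesis using k(2) by linarith
  qed
  have col: "q \<le> w div x + 1 \<and> w div x \<le> q" if "b \<le> w" "w \<le> v k" for w
  proof -
    have "q - 1 \<le> w div x" using div_le_mono[OF that(1), of x] x by (simp add: b_def)
    then show ?thesis using div_le_mono[OF that(2), of x] by (simp add: k(3))
  qed
  have row: "m \<le> r div x + 1 \<and> r div x \<le> m" if "r \<le> t k" "t k \<le> r + x" for r
    using div_le_mono[OF that(1), of x] div_le_mono[OF that(2), of x] x by (simp add: k(4))
  have fin: "finite (Hs F \<inter> near (j, q, m))" "finite (Vs F \<inter> near (j, q, m))"
    using finite_Hs[OF finF] finite_Vs[OF finF] by simp_all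
  have "b < v k" using b x by linarith
  from reach_box[OF reach[OF k(1)] F \<open>v0 \<le> b\<close> this, of x] show ?thesis
  proof
    assume a: "\<forall>w\<in>{b..<v k}. \<exists>r\<le>t k. t k \<le> r + x \<and> hor (w, r) \<in> F"
    have "v k - b \<le> card (Hs F \<inter> near (j, q, m))"
    proof (rule card_columns_le[OF fin(1)])
      fix w assume w: "w \<in> {b..<v k}"
      with a have "\<exists>r\<le>t k. t k \<le> r + x \<and> hor (w, r) \<in> F" by (rule bspec)
      then obtain r where r: "r \<le> t k" "t k \<le> r + x" "hor (w, r) \<in> F" by (elim exE conjE)
      then have "(w, r) \<in> Hs F \<inter> near (j, q, m)"
        using col[of w] row[of r] w by (simp add: Hs_def near_def x_def)
      then show "\<exists>r. (w, r) \<in> Hs F \<inter> near (j, q, m)" ..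
    qed
    then show ?thesis using b by (simp add: x_def)
  next
    assume a: "x \<le> t k \<and> (\<forall>r\<in>{t k - x..<t k}. \<exists>w\<in>{b<..v k}. ver (w, r) \<in> F)"
    have "t k - (t k - x) \<le> card (Vs F \<inter> near (j, q, m))"
    proof (rule card_rows_le[OF fin(2)])
      fix r assume r: "r \<in> {t k - x..<t k}"
      have "\<exists>w\<in>{b<..v k}. ver (w, r) \<in> F" using conjunct2[OF a] r by (rule bspec)
      then obtain w where w: "w \<in> {b<..v k}" "ver (w, r) \<in> F" by (elim bexE)
      have "r \<le> t k" "t k \<le> r + x" using r by auto
      then have "(w, r) \<in> Vs F \<inter> near (j, q, m)"
        using col[of w] row[of r] w by (simp add: Vs_def near_def x_def)
      then show "\<exists>w. (w, r) \<in> Vs F \<inter> near (j, q, m)" ..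
    qed
    then show ?thesis using a by (simp add: x_def)
  qed
qed

lemma finite_guards: "finite (guards s)"
proof (rule finite_subset)
  show "guards s \<subseteq> (\<lambda>(j, q, m). (j, q)) ` cells"
    unfolding guards_def cells_def by force
qed (simp add: finite_cells)

text \<open>A guard started in time slice \<open>m\<close> is active only during slices
  \<open>m\<close> and \<open>m + 1\<close>, that is for \<open>2 * d ^ j\<close> ticks, at most
  twice the cost of its cell. An edge is near at most \<open>4 * (d + 4)\<close> cells, and
  \<open>8 * (d + 4) \<le> 24 * d\<close>.\<close>

lemma sum_guards: "(\<Sum>s<T. card (guards s)) \<le> 24 * d * card F"
proof -
  let ?I = "\<lambda>(j, q, m). {m * d ^ j..<m * d ^ j + 2 * d ^ j} \<times> {(j, q)}"
  have "(\<Sum>s<T. card (guards s)) = card (Sigma {..<T} guards)"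
    using finite_guards by (intro card_SigmaI[symmetric]) simp_all
  also have "\<dots> \<le> card (\<Union>z\<in>cells. ?I z)"
  proof (rule card_mono)
    show "finite (\<Union>z\<in>cells. ?I z)" using finite_cells by (intro finite_UN_I) auto
    show "Sigma {..<T} guards \<subseteq> (\<Union>z\<in>cells. ?I z)"
    proof clarify
      fix s j q assume "(j, q) \<in> guards s"
      then obtain k where k: "k \<in> K" "t k \<le> s" "s < t k + d ^ j" "v k div d ^ j = q" "guarded k j"
        unfolding guards_def by blast
      define m where "m = t k div d ^ j"
      have "m * d ^ j \<le> t k" by (simp add: m_def)
      moreover have "t k < m * d ^ j + d ^ j"
        using dividend_less_div_times[OF d_pow_pos[of j], of "t k"] by (simp add: m_def)
      ultimately have "(s, j, q) \<in> ?I (j, q, m)" using k(2,3) by simp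
      moreover have "(j, q, m) \<in> cells"
        unfolding cells_def m_def using k by (intro image_eqI[of _ _ "(k, j)"]) simp_all
      ultimately show "(s, j, q) \<in> (\<Union>z\<in>cells. ?I z)" by blast
    qed
  qed
  also have "\<dots> \<le> (\<Sum>z\<in>cells. card (?I z))" by (rule card_UN_le[OF finite_cells])
  also have "\<dots> \<le> (\<Sum>z\<in>cells. 2 * (card (Hs F \<inter> near z) + card (Vs F \<inter> near z)))"
  proof (rule sum_mono)
    fix z assume z: "z \<in> cells"
    obtain j q m where "z = (j, q, m)" by (cases z)
    then show "card (?I z) \<le> 2 * (card (Hs F \<inter> near z) + card (Vs F \<inter> near z))"
      using cell_cost[of j q m] z by (simp add: card_cartesian_product)
  qed
  also have "\<dots> = 2 * ((\<Sum>z\<in>cells. card (Hs F \<inter> near z)) + (\<Sum>z\<in>cells. card (Vs F \<inter> near z)))"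
    by (simp add: sum_distrib_left sum.distrib)
  also have "\<dots> \<le> 2 * (4 * (d + 4) * card (Hs F) + 4 * (d + 4) * card (Vs F))"
  proof (intro mult_le_mono2 add_mono)
    show "(\<Sum>z\<in>cells. card (Hs F \<inter> near z)) \<le> 4 * (d + 4) * card (Hs F)"
      using card_near_cells by (intro double_count[OF finite_cells finite_Hs[OF finF]]) simp_all
    show "(\<Sum>z\<in>cells. card (Vs F \<inter> near z)) \<le> 4 * (d + 4) * card (Vs F)"
      using card_near_cells by (intro double_count[OF finite_cells finite_Vs[OF finF]]) simp_all
  qed
  also have "\<dots> = (8 * (d + 4)) * (card (Hs F) + card (Vs F))" by (simp add: algebra_simps)
  also have "\<dots> \<le> (24 * d) * card F"
  proof (rule mult_le_mono)
    have "8 * d + 32 \<le> 24 * d" using d by linarith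
    then show "8 * (d + 4) \<le> 24 * d" by (simp add: algebra_simps)
  qed (rule card_Hs_Vs_le[OF finF])
  finally show ?thesis .
qed

end

section \<open>The online algorithm\<close>

type_synonym entry = "nat \<times> nat \<times> nat \<times> nat"
text \<open>The available columns, and one entry \<open>(u, v, t, d)\<close> per past request: \<open>(v, t)\<close> was served from column
  \<open>u\<close> with base \<open>d\<close>.\<close>

type_synonym state = "nat set \<times> entry list"

text \<open>The least base \<open>d = 2 ^ p\<close> with \<open>d ^ d > k\<close> or \<open>d ^ d \<ge> n\<close>, where \<open>k\<close> requests were seen before: the final
  number of requests is not known in advance.\<close>

definition phase_base :: "nat \<Rightarrow> nat \<Rightarrow> nat" where
  "phase_base n k = 2 ^ (LEAST p. 1 \<le> p \<and> (k < (2 ^ p) ^ (2 ^ p) \<or> n \<le> (2 ^ p) ^ (2 ^ p)))"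

text \<open>Tick \<open>s\<close> stores from time \<open>s\<close> to \<open>s + 1\<close>, so the
  strict upper bound on \<open>s\<close> makes a column available up to and including the end of its
  holding time. \<open>guard_on\<close> follows the same convention.\<close>

definition line_kept :: "entry \<Rightarrow> nat \<Rightarrow> nat \<Rightarrow> bool" where
  "line_kept = (\<lambda>(u, v, t, d) s w. u < v \<and> u \<le> w \<and> w \<le> v \<and> t \<le> s \<and>
     (\<exists>j\<le>level d (v - u). (w = u \<or> w = v \<or> d ^ j dvd w) \<and> s < t + hold d (level d (v - u)) j))"

definition guard_on :: "nat \<Rightarrow> entry \<Rightarrow> nat \<Rightarrow> nat \<Rightarrow> nat \<Rightarrow> nat \<Rightarrow> bool" where
  "guard_on v0 = (\<lambda>(u, v, t, d) s e j q. e = d \<and> u < v \<and> t \<le> s \<and> s < t + d ^ j \<and> v div d ^ j = q \<and>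
     v0 < d ^ j * (v div d ^ j - 2) \<and> v - v0 \<le> d ^ j * d ^ (d + 2))"

text \<open>A guard is the first available column from \<open>d ^ j * (q - 2)\<close> on. It is shared by all entries in the cell \<open>q\<close>
  of the scale \<open>d ^ j\<close>, which is what makes guards affordable.\<close>

definition keep :: "nat \<Rightarrow> entry list \<Rightarrow> nat \<Rightarrow> nat set \<Rightarrow> nat set" where
  "keep v0 es s S = {v0} \<union> {w \<in> S. \<exists>e\<in>set es. line_kept e s w} \<union>
     {c \<in> S. \<exists>e\<in>set es. \<exists>d j q. guard_on v0 e s d j q \<and> d ^ j * (q - 2) \<le> c \<and>
        (\<forall>w\<in>S. d ^ j * (q - 2) \<le> w \<longrightarrow> c \<le> w)}"

definition nearest :: "nat set \<Rightarrow> nat \<Rightarrow> nat" where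
  "nearest S v = Max {w \<in> S. w \<le> v}"

fun step :: "nat \<Rightarrow> nat \<Rightarrow> state \<Rightarrow> event \<Rightarrow> state" where
  "step n v0 (S, es) (Request (v, t)) =
     (S \<union> {nearest S v..v}, es @ [(nearest S v, v, t, phase_base n (length es))])"
| "step n v0 (S, es) (Tick s) = (keep v0 es s S, es)"

definition state :: "nat \<Rightarrow> nat \<Rightarrow> event list \<Rightarrow> state" where
  "state n v0 past = foldl (step n v0) ({v0}, []) past"

text \<open>The intersections make the added edges legal for all arguments. On valid inputs they
  remove nothing, as available columns then lie in \<open>{v0..n}\<close>.\<close>

definition alg :: algorithm where
  "alg n v0 past e F = (let (S, es) = state n v0 past in
     case e of
       Request (v, t) \<Rightarrow> hor ` ({nearest S v..<v} \<times> {t}) \<inter> horizontal_edges n t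
     | Tick s \<Rightarrow> ver ` (keep v0 es s S \<times> {s}) \<inter> arcs n s)"

lemma online_alg: "online_algorithm alg"
  by (auto simp: online_algorithm_def alg_def split: event.splits prod.splits)

lemma run_snoc:
  "run A n v0 past F (es @ [e]) = run A n v0 past F es \<union> A n v0 (past @ es) e (run A n v0 past F es)"
  by (induction es arbitrary: past F) auto

lemma run_mono: "run A n v0 past F es \<subseteq> run A n v0 past F (es @ fs)"
proof (induction fs rule: rev_induct)
  case (snoc f fs)
  then show ?case using run_snoc[of A n v0 past F "es @ fs" f] by auto
qed simp

definition end_time :: "nat \<Rightarrow> replica list \<Rightarrow> nat" where
  "end_time s rs = (if rs = [] then s else snd (last rs))"

lemma end_time_snoc: "end_time s (rs @ [r]) = snd r"
  by (simp add: end_time_def)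

lemma events_append: "events s (rs @ rs') = events s rs @ events (end_time s rs) rs'"
  by (induction rs arbitrary: s) (auto simp: end_time_def)

lemma events_snoc: "events s (rs @ [r]) = events s rs @ map Tick [end_time s rs..<snd r] @ [Request r]"
  by (simp add: events_append)

lemma state_snoc: "state n v0 (p @ [e]) = step n v0 (state n v0 p) e"
  by (simp add: state_def)

section \<open>Feasibility of the solution built by the algorithm\<close>

locale instance_size =
  fixes n v0 :: nat
  assumes v0: "1 \<le> v0" "v0 \<le> n"
begin

abbreviation S :: "event list \<Rightarrow> nat set" where "S p \<equiv> fst (state n v0 p)"
abbreviation E :: "event list \<Rightarrow> entry list" where "E p \<equiv> snd (state n v0 p)"
abbreviation G :: "event list \<Rightarrow> edge set" where "G p \<equiv> run alg n v0 [] {} p"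

lemma S_Request: "S (p @ [Request (v, t)]) = S p \<union> {nearest (S p) v..v}"
  and E_Request: "E (p @ [Request (v, t)]) = E p @ [(nearest (S p) v, v, t, phase_base n (length (E p)))]"
  and S_Tick: "S (p @ [Tick s]) = keep v0 (E p) s (S p)"
  and E_Tick: "E (p @ [Tick s]) = E p"
  by (cases "state n v0 p"; simp add: state_snoc)+

lemma G_Request: "G (p @ [Request (v, t)]) = G p \<union> hor ` ({nearest (S p) v..<v} \<times> {t}) \<inter> horizontal_edges n t"
  and G_Tick: "G (p @ [Tick s]) = G p \<union> ver ` (keep v0 (E p) s (S p) \<times> {s}) \<inter> arcs n s"
  by (simp_all add: run_snoc alg_def split: prod.splits)

text \<open>The state merely claims that columns are available. This invariant backs the claim by
  paths in the edges bought so far, which makes serving from the nearest column feasible.\<close>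

definition valid :: "event list \<Rightarrow> nat \<Rightarrow> bool" where
  "valid p s \<longleftrightarrow> v0 \<in> S p \<and> S p \<subseteq> {v0..n} \<and> finite (G p) \<and> G p \<subseteq> timeline_edges n \<and>
     (\<forall>w\<in>S p. ((v0, 0), (w, s)) \<in> (G p)\<^sup>*)"

lemma valid_Nil: "valid [] 0"
  using v0 by (simp add: valid_def state_def)

lemma keep_subset: "v0 \<in> X \<Longrightarrow> keep v0 es s X \<subseteq> X"
  by (auto simp: keep_def)

lemma finite_arcs: "finite (arcs n s)"
proof -
  have "arcs n s = ver ` ({1..n} \<times> {s})" unfolding arcs_ver by auto
  then show ?thesis by simp
qed

lemma finite_horizontal_edges: "finite (horizontal_edges n s)"
proof -
  have "horizontal_edges n s \<subseteq> hor ` ({1..n} \<times> {s})" unfolding horizontal_edges_hor by auto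
  then show ?thesis by (rule finite_subset) simp
qed

lemma valid_Tick:
  assumes "valid p s" shows "valid (p @ [Tick s]) (s + 1)"
proof -
  have sub: "keep v0 (E p) s (S p) \<subseteq> S p"
    using assms by (intro keep_subset) (simp add: valid_def)
  have "((v0, 0), (w, s + 1)) \<in> (G (p @ [Tick s]))\<^sup>*" if w: "w \<in> keep v0 (E p) s (S p)" for w
  proof -
    have "w \<in> S p" using sub w by blast
    then have "((v0, 0), (w, s)) \<in> (G p)\<^sup>*" and r: "v0 \<le> w" "w \<le> n" using assms by (auto simp: valid_def)
    then have "((v0, 0), (w, s)) \<in> (G (p @ [Tick s]))\<^sup>*"
      using rtrancl_mono[OF run_mono[of alg n v0 "[]" "{}" p "[Tick s]"]] by blast
    moreover have "ver (w, s) \<in> arcs n s" using r v0 by (auto simp: arcs_ver)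
    then have "ver (w, s) \<in> G (p @ [Tick s])" using w by (simp add: G_Tick)
    then have "((w, s), (w, s + 1)) \<in> G (p @ [Tick s])" by (simp add: ver_def)
    ultimately show ?thesis by (rule rtrancl_into_rtrancl)
  qed
  moreover have "v0 \<in> keep v0 (E p) s (S p)" by (simp add: keep_def)
  moreover have "arcs n s \<subseteq> timeline_edges n" by (auto simp: timeline_edges_def)
  ultimately show ?thesis
    using assms sub finite_arcs[of s] unfolding valid_def S_Tick G_Tick by blast
qed

lemma nearest:
  assumes "v0 \<in> X" "X \<subseteq> {v0..n}" "v0 \<le> v"
  shows "nearest X v \<in> X" "nearest X v \<le> v" "v0 \<le> nearest X v" "\<And>w. w \<in> X \<Longrightarrow> w \<le> v \<Longrightarrow> w \<le> nearest X v"
proof -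
  have fin: "finite {w \<in> X. w \<le> v}" by simp
  have "{w \<in> X. w \<le> v} \<noteq> {}" using assms by blast
  from Max_in[OF fin this] show "nearest X v \<in> X" "nearest X v \<le> v" by (simp_all add: nearest_def)
  then show "v0 \<le> nearest X v" using assms(2) by auto
  show "\<And>w. w \<in> X \<Longrightarrow> w \<le> v \<Longrightarrow> w \<le> nearest X v" unfolding nearest_def using Max_ge[OF fin] by simp
qed

lemma valid_Request:
  assumes "valid p t" "v0 \<le> v" "v \<le> n"
  shows "valid (p @ [Request (v, t)]) t" "((v0, 0), (v, t)) \<in> (G (p @ [Request (v, t)]))\<^sup>*"
proof -
  define u where "u = nearest (S p) v"
  let ?G = "G (p @ [Request (v, t)])"
  have u: "u \<in> S p" "u \<le> v" "v0 \<le> u"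
    using nearest[of "S p" v] assms unfolding valid_def u_def by blast+
  have up: "(G p)\<^sup>* \<subseteq> ?G\<^sup>*" by (rule rtrancl_mono[OF run_mono])
  have reach: "u \<le> w \<Longrightarrow> w \<le> v \<Longrightarrow> ((v0, 0), (w, t)) \<in> ?G\<^sup>*" for w
  proof (induction rule: dec_induct)
    case base
    then show ?case using assms(1) u(1) up unfolding valid_def by blast
  next
    case (step w)
    have "hor (w, t) \<in> horizontal_edges n t"
      using step u(3) v0 assms(3) by (auto simp: horizontal_edges_hor)
    then have "hor (w, t) \<in> ?G" using step by (simp add: G_Request u_def)
    then have "((w, t), (Suc w, t)) \<in> ?G" by (simp add: hor_def)
    moreover have "((v0, 0), (w, t)) \<in> ?G\<^sup>*" using step by simp
    ultimately show ?case by (rule rtrancl_into_rtrancl[rotated])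
  qed
  show "((v0, 0), (v, t)) \<in> ?G\<^sup>*" using reach[of v] u by simp
  have "horizontal_edges n t \<subseteq> timeline_edges n" by (auto simp: timeline_edges_def)
  then have "?G \<subseteq> timeline_edges n" "finite ?G"
    using assms(1) finite_horizontal_edges[of t] unfolding valid_def G_Request by blast+
  moreover have "S (p @ [Request (v, t)]) \<subseteq> {v0..n}"
    using assms u(3) unfolding S_Request valid_def u_def[symmetric] by auto
  moreover have "((v0, 0), (w, t)) \<in> ?G\<^sup>*" if "w \<in> S (p @ [Request (v, t)])" for w
  proof (cases "w \<in> S p")
    case True then show ?thesis using assms(1) up unfolding valid_def by blast
  next
    case False
    then have "w \<in> {u..v}" using that unfolding S_Request u_def by blast
    then show ?thesis using reach by simp
  qed
  ultimately show "valid (p @ [Request (v, t)]) t"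
    using assms(1) unfolding valid_def S_Request by blast
qed

lemma valid_Ticks:
  "s \<le> t \<Longrightarrow> valid p s \<Longrightarrow> valid (p @ map Tick [s..<t]) t"
proof (induction rule: dec_induct)
  case (step t)
  then have "valid (p @ map Tick [s..<t]) t" by simp
  from valid_Tick[OF this] step.hyps show ?case by simp
qed simp

definition before :: "replica list \<Rightarrow> nat \<Rightarrow> event list" where
  "before rs k = events 0 (take k rs) @ map Tick [end_time 0 (take k rs)..<snd (rs ! k)]"

lemma events_take_Suc:
  "k < length rs \<Longrightarrow> events 0 (take (Suc k) rs) = before rs k @ [Request (rs ! k)]"
  by (simp add: take_Suc_conv_app_nth events_snoc before_def)

definition ordered :: "replica list \<Rightarrow> bool" where
  "ordered rs \<longleftrightarrow> sorted (map snd rs) \<and> (\<forall>r\<in>set rs. v0 \<le> fst r \<and> fst r \<le> n)"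

lemma end_time_le:
  assumes "ordered rs" "k < length rs"
  shows "end_time 0 (take k rs) \<le> snd (rs ! k)"
proof (cases k)
  case (Suc m)
  have "last (take (Suc m) rs) = rs ! m" using assms(2) Suc by (simp add: take_Suc_conv_app_nth)
  moreover have "snd (rs ! m) \<le> snd (rs ! Suc m)"
    using sorted_nth_mono[of "map snd rs" m "Suc m"] assms Suc by (simp add: ordered_def)
  ultimately show ?thesis using Suc assms(2) by (auto simp: end_time_def)
qed (simp add: end_time_def)

lemma valid_take:
  assumes "ordered rs" "k \<le> length rs"
  shows "valid (events 0 (take k rs)) (end_time 0 (take k rs)) \<and>
    (\<forall>r\<in>set (take k rs). ((v0, 0), r) \<in> (G (events 0 (take k rs)))\<^sup>*)"
  using assms(2)
proof (induction k)
  case 0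
  then show ?case by (simp add: valid_Nil end_time_def)
next
  case (Suc k)
  then have k: "k < length rs" by simp
  obtain v t where r: "rs ! k = (v, t)" by (cases "rs ! k")
  have "v0 \<le> v" "v \<le> n" using assms(1) nth_mem[OF k] r by (auto simp: ordered_def)
  moreover have "valid (before rs k) t"
    using valid_Ticks[OF end_time_le[OF assms(1) k]] Suc k by (simp add: before_def r)
  ultimately have v: "valid (events 0 (take (Suc k) rs)) t"
    "((v0, 0), (v, t)) \<in> (G (events 0 (take (Suc k) rs)))\<^sup>*"
    using valid_Request[of "before rs k" t v] by (simp_all add: events_take_Suc[OF k] r)
  have "(G (events 0 (take k rs)))\<^sup>* \<subseteq> (G (events 0 (take (Suc k) rs)))\<^sup>*"
    unfolding events_take_Suc[OF k] before_def append_assoc by (rule rtrancl_mono[OF run_mono])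
  moreover have "end_time 0 (take (Suc k) rs) = t" using k r by (simp add: take_Suc_conv_app_nth end_time_def)
  ultimately show ?case using v Suc k r by (auto simp: take_Suc_conv_app_nth)
qed

lemma valid_before:
  assumes "ordered rs" "k < length rs"
  shows "valid (before rs k) (snd (rs ! k))"
  using valid_Ticks[OF end_time_le[OF assms]] valid_take[OF assms(1), of k] assms(2)
  by (simp add: before_def)

lemma feasible_alg:
  assumes "ordered rs"
  shows "feasible n v0 rs (solution alg n v0 rs)"
  using valid_take[OF assms, of "length rs"] by (auto simp: feasible_def solution_def valid_def)

section \<open>Kept columns remain available until a later request\<close>

definition entry :: "replica list \<Rightarrow> nat \<Rightarrow> entry" where
  "entry rs k = (nearest (S (before rs k)) (fst (rs ! k)), fst (rs ! k), snd (rs ! k), phase_base n k)"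

lemma E_Ticks: "E (p @ map Tick xs) = E p"
proof (induction xs rule: rev_induct)
  case (snoc x xs)
  then show ?case using E_Tick[of "p @ map Tick xs" x] by simp
qed simp

lemma E_events: "m \<le> length rs \<Longrightarrow> E (events 0 (take m rs)) = map (entry rs) [0..<m]"
proof (induction m)
  case (Suc m)
  then have m: "m < length rs" by simp
  obtain v t where r: "rs ! m = (v, t)" by (cases "rs ! m")
  have "E (before rs m) = map (entry rs) [0..<m]" using Suc by (simp add: before_def E_Ticks)
  then show ?case unfolding events_take_Suc[OF m] r by (simp add: E_Request entry_def r)
qed (simp add: state_def)

lemma persist_Ticks:
  assumes "P (S p)" "\<And>x X. x \<in> set xs \<Longrightarrow> P X \<Longrightarrow> P (keep v0 (E p) x X)"
  shows "P (S (p @ map Tick xs))"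
  using assms(2)
proof (induction xs rule: rev_induct)
  case (snoc x xs)
  then have "P (S (p @ map Tick xs))" by simp
  then have "P (keep v0 (E p) x (S (p @ map Tick xs)))" using snoc.prems by simp
  then show ?case using S_Tick[of "p @ map Tick xs" x] by (simp add: E_Ticks)
qed (simp add: assms(1))

text \<open>Requests only enlarge the available set, so a property closed under union can be lost
  only at ticks, and the ticks in between all know the entry of \<open>k1\<close>. A general
  \<open>P\<close> covers both lines, where one column stays, and guards, where the column may
  change.\<close>

lemma persist:
  assumes rs: "ordered rs" and k: "k1 < k2" "k2 < length rs"
    and start: "P (S (before rs k1) \<union> {nearest (S (before rs k1)) (fst (rs ! k1))..fst (rs ! k1)})"
    and up: "\<And>X Y. P X \<Longrightarrow> P (X \<union> Y)"
    and kp: "\<And>es x X. \<lbrakk>entry rs k1 \<in> set es; snd (rs ! k1) \<le> x; x < snd (rs ! k2); P X\<rbrakk> \<Longrightarrow> P (keep v0 es x X)"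
  shows "P (S (before rs k2))"
proof -
  have times: "i \<le> j \<Longrightarrow> j < length rs \<Longrightarrow> snd (rs ! i) \<le> snd (rs ! j)" for i j
    using rs sorted_nth_mono[of "map snd rs" i j] by (simp add: ordered_def)
  have SR: "S (p @ [Request r]) = S p \<union> {nearest (S p) (fst r)..fst r}" for p r
    using S_Request[of p "fst r" "snd r"] by simp
  have before: "P (S (before rs k))" if "P (S (events 0 (take k rs)))" "Suc k1 \<le> k" "k \<le> k2" for k
    unfolding before_def
  proof (rule persist_Ticks[where P = P, OF that(1)])
    fix x X assume x: "x \<in> set [end_time 0 (take k rs)..<snd (rs ! k)]" and P: "P X"
    have "k \<noteq> 0" using that(2) by simp
    then obtain m where m: "k = Suc m" using not0_implies_Suc by blast
    have "take k rs = take m rs @ [rs ! m]" using m that(3) k(2) by (simp add: take_Suc_conv_app_nth)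
    then have "end_time 0 (take k rs) = snd (rs ! m)" by (simp add: end_time_snoc)
    moreover have "snd (rs ! k1) \<le> snd (rs ! m)" "snd (rs ! k) \<le> snd (rs ! k2)"
      using times[of k1 m] times[of k k2] m that k(2) by simp_all
    ultimately have "snd (rs ! k1) \<le> x" "x < snd (rs ! k2)" using x by simp_all
    moreover have "entry rs k1 \<in> set (E (events 0 (take k rs)))"
      using that k(2) by (simp add: E_events)
    ultimately show "P (keep v0 (E (events 0 (take k rs))) x X)" using P by (intro kp)
  qed
  have "P (S (events 0 (take k2 rs)))" using k(1)[THEN Suc_leI]
  proof (rule dec_induct)
    show "P (S (events 0 (take (Suc k1) rs)))"
      using start k unfolding events_take_Suc[OF less_trans[OF k]] SR by simp
  next
    fix m assume m: "Suc k1 \<le> m" "m < k2" and P: "P (S (events 0 (take m rs)))"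
    have "m < length rs" using m k by simp
    then show "P (S (events 0 (take (Suc m) rs)))"
      unfolding events_take_Suc[OF \<open>m < length rs\<close>] SR using before[OF P] m by (intro up) simp
  qed
  then show ?thesis using k by (intro before) simp_all
qed

lemma v0_in_before:
  assumes "ordered rs" "k < length rs" shows "v0 \<in> S (before rs k)" "S (before rs k) \<subseteq> {v0..n}"
  using valid_before[OF assms] by (auto simp: valid_def)

lemma entry_bounds:
  assumes "ordered rs" "k < length rs"
  shows "v0 \<le> fst (entry rs k)" "fst (entry rs k) \<le> fst (rs ! k)"
    "\<And>w. w \<in> S (before rs k) \<Longrightarrow> w \<le> fst (rs ! k) \<Longrightarrow> w \<le> fst (entry rs k)"
proof -
  have "v0 \<le> fst (rs ! k)" using assms nth_mem[of k rs] by (auto simp: ordered_def)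
  note N = nearest[OF v0_in_before[OF assms] this]
  show "v0 \<le> fst (entry rs k)" "fst (entry rs k) \<le> fst (rs ! k)"
    "\<And>w. w \<in> S (before rs k) \<Longrightarrow> w \<le> fst (rs ! k) \<Longrightarrow> w \<le> fst (entry rs k)"
    using N by (simp_all add: entry_def)
qed

lemma line_available:
  assumes rs: "ordered rs" and k: "k1 < k2" "k2 < length rs"
    and uv: "fst (entry rs k1) < fst (rs ! k1)"
    and w: "fst (entry rs k1) \<le> w" "w \<le> fst (rs ! k1)"
      "w = fst (entry rs k1) \<or> w = fst (rs ! k1) \<or> phase_base n k1 ^ j dvd w"
    and j: "j \<le> level (phase_base n k1) (fst (rs ! k1) - fst (entry rs k1))"
    and t: "snd (rs ! k2) \<le> snd (rs ! k1) +
      hold (phase_base n k1) (level (phase_base n k1) (fst (rs ! k1) - fst (entry rs k1))) j"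
  shows "w \<in> S (before rs k2)"
proof (rule persist[OF rs k, where P = "\<lambda>X. w \<in> X"])
  show "w \<in> S (before rs k1) \<union> {nearest (S (before rs k1)) (fst (rs ! k1))..fst (rs ! k1)}"
    using w(1,2) by (simp add: entry_def)
next
  fix es x X
  assume e: "entry rs k1 \<in> set es" and x: "snd (rs ! k1) \<le> x" "x < snd (rs ! k2)" and X: "w \<in> X"
  have "line_kept (entry rs k1) x w"
    using uv w j t x unfolding line_kept_def entry_def by auto
  then show "w \<in> keep v0 es x X" using e X unfolding keep_def by blast
qed simp

text \<open>A guard is not a fixed column: a later service may make a column closer to
  \<open>L\<close> available, which is then kept instead. So the invariant is that some available
  column lies between \<open>L\<close> and the initial position of the guard.\<close>

lemma guard_available:
  assumes rs: "ordered rs" and k: "k1 < k2" "k2 < length rs"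
    and uv: "fst (entry rs k1) < fst (rs ! k1)" and D: "D = phase_base n k1 ^ j"
    and L: "L = D * (fst (rs ! k1) div D - 2)"
    and g: "fst (rs ! k1) - v0 \<le> D * phase_base n k1 ^ (phase_base n k1 + 2)"
    and t: "snd (rs ! k2) \<le> snd (rs ! k1) + D"
  shows "\<exists>c\<in>S (before rs k2). L \<le> c \<and> c \<le> max (fst (entry rs k1)) L"
proof (cases "v0 < L")
  case False
  moreover have "v0 \<le> fst (entry rs k1)" using entry_bounds(1)[OF rs] k by simp
  ultimately show ?thesis using v0_in_before(1)[OF rs k(2)] by (intro bexI[of _ v0]) simp_all
next
  case True
  let ?h = "max (fst (entry rs k1)) L"
  show ?thesis
  proof (rule persist[OF rs k, where P = "\<lambda>X. \<exists>c\<in>X. L \<le> c \<and> c \<le> ?h"])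
    have "D * (fst (rs ! k1) div D - 2) \<le> D * (fst (rs ! k1) div D)" by (rule mult_le_mono2) simp
    also have "\<dots> \<le> fst (rs ! k1)" by simp
    finally have "?h \<le> fst (rs ! k1)" using uv L by simp
    then have "?h \<in> {nearest (S (before rs k1)) (fst (rs ! k1))..fst (rs ! k1)}"
      by (simp add: entry_def)
    then show "\<exists>c\<in>S (before rs k1) \<union> {nearest (S (before rs k1)) (fst (rs ! k1))..fst (rs ! k1)}.
        L \<le> c \<and> c \<le> ?h" by (intro bexI[of _ ?h]) simp_all
  next
    fix es x X
    assume e: "entry rs k1 \<in> set es" and x: "snd (rs ! k1) \<le> x" "x < snd (rs ! k2)"
      and X: "\<exists>c\<in>X. L \<le> c \<and> c \<le> ?h"
    define c where "c = (LEAST c. c \<in> X \<and> L \<le> c)"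
    from X obtain c' where c': "c' \<in> X" "L \<le> c'" "c' \<le> ?h" by blast
    have c: "c \<in> X" "L \<le> c" using LeastI[of "\<lambda>c. c \<in> X \<and> L \<le> c" c'] c' unfolding c_def by blast+
    have least: "c \<le> w" if "w \<in> X" "L \<le> w" for w using that unfolding c_def by (intro Least_le) simp
    have "guard_on v0 (entry rs k1) x (phase_base n k1) j (fst (rs ! k1) div D)"
      using uv g t x True unfolding guard_on_def entry_def L D by auto
    then have "c \<in> keep v0 es x X"
      using e c least unfolding keep_def L D by blast
    moreover have "c \<le> ?h" using least[OF c'(1,2)] c'(3) by simp
    ultimately show "\<exists>c\<in>keep v0 es x X. L \<le> c \<and> c \<le> ?h" using c(2) by blast
  qed blast
qed

end

lemma phase_base:
  obtains p where "phase_base n k = 2 ^ p" "1 \<le> p" "k < (2 ^ p) ^ (2 ^ p) \<or> n \<le> (2 ^ p) ^ (2 ^ p)"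
    "\<And>q. 1 \<le> q \<Longrightarrow> q < p \<Longrightarrow> (2 ^ q) ^ (2 ^ q) \<le> k \<and> (2 ^ q) ^ (2 ^ q) < n"
proof -
  let ?Q = "\<lambda>p. 1 \<le> p \<and> (k < ((2::nat) ^ p) ^ (2 ^ p) \<or> n \<le> (2 ^ p) ^ (2 ^ p))"
  define p where "p = (LEAST p. ?Q p)"
  have "k < (2 ^ Suc k) ^ (2 ^ Suc k)"
  proof -
    have "k < Suc k" by simp
    also have "Suc k < 2 ^ Suc k" by (rule less_exp)
    also have "(2::nat) ^ Suc k \<le> (2 ^ Suc k) ^ (2 ^ Suc k)" by (rule self_le_power) simp_all
    finally show ?thesis .
  qed
  then have "?Q (Suc k)" by simp
  then have Q: "?Q p" unfolding p_def by (rule LeastI)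
  show thesis
  proof (rule that[of p])
    show "phase_base n k = 2 ^ p" by (simp add: phase_base_def p_def)
    fix q :: nat assume "1 \<le> q" "q < p"
    then have "\<not> ?Q q" using not_less_Least[of q ?Q] unfolding p_def by blast
    then show "(2 ^ q) ^ (2 ^ q) \<le> k \<and> (2 ^ q) ^ (2 ^ q) < n"
      using \<open>1 \<le> q\<close> by (simp add: not_less not_le)
  qed (use Q in simp_all)
qed

lemma phase_base_ge_2: "2 \<le> phase_base n k"
proof -
  obtain p where "phase_base n k = 2 ^ p" "1 \<le> p" by (rule phase_base)
  then show ?thesis using power_increasing[of 1 p "2::nat"] by simp
qed

section \<open>The cost of the algorithm\<close>

text \<open>The 4 consists of the two ends, one for counting both end points of a range of
  multiples, and one for rounding.\<close>

lemma card_multiples_le: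
  assumes "0 < x" "u \<le> (v::nat)"
  shows "finite {w. u \<le> w \<and> w \<le> v \<and> (w = u \<or> w = v \<or> x dvd w)}"
    "card {w. u \<le> w \<and> w \<le> v \<and> (w = u \<or> w = v \<or> x dvd w)} \<le> (v - u) div x + 4"
proof -
  let ?W = "{w. u \<le> w \<and> w \<le> v \<and> (w = u \<or> w = v \<or> x dvd w)}"
  let ?M = "(\<lambda>i. x * i) ` {u div x..v div x}"
  have sub: "?W \<subseteq> {u, v} \<union> ?M"
  proof
    fix w assume "w \<in> ?W"
    then have w: "u \<le> w" "w \<le> v" "w = u \<or> w = v \<or> x dvd w" by simp_all
    show "w \<in> {u, v} \<union> ?M"
    proof (cases "x dvd w")
      case True
      then have "w = x * (w div x)" by simp
      moreover have "w div x \<in> {u div x..v div x}" using w(1,2) by (simp add: div_le_mono)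
      ultimately show ?thesis by blast
    qed (use w(3) in blast)
  qed
  then show "finite ?W" by (rule finite_subset) simp
  have "card ?W \<le> card ({u, v} \<union> ?M)" using sub by (intro card_mono) simp_all
  also have "\<dots> \<le> card {u, v} + card ?M" by (rule card_Un_le)
  also have "card {u, v} \<le> 2" by (simp add: card_insert_if)
  also have "card ?M \<le> card {u div x..v div x}" by (rule card_image_le) simp
  also have "\<dots> = v div x + 1 - u div x" by simp
  finally have c: "card ?W \<le> 2 + (v div x + 1 - u div x)" by simp
  have "v = u + (v - u)" using assms(2) by simp
  then have "v div x = (u + (v - u)) div x" by simp
  also have "\<dots> = u div x + (v - u) div x + (u mod x + (v - u) mod x) div x" by (rule div_add1_eq)
  also have "(u mod x + (v - u) mod x) div x \<le> 1"
  proof -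
    have "u mod x + (v - u) mod x < 2 * x"
      using mod_less_divisor[OF assms(1), of u] mod_less_divisor[OF assms(1), of "v - u"] by linarith
    then show ?thesis using assms(1) by (simp add: less_mult_imp_div_less Suc_leI flip: less_Suc_eq_le)
  qed
  finally show "card ?W \<le> (v - u) div x + 4" using c by linarith
qed

lemma sum_window_le: "(\<Sum>s<T. if t \<le> s \<and> s < t + h then c else 0) \<le> h * (c::nat)"
proof -
  have "(\<Sum>s<T. if t \<le> s \<and> s < t + h then c else 0) = card ({..<T} \<inter> {s. t \<le> s \<and> s < t + h}) * c"
    by (simp add: sum.If_cases)
  also have "card ({..<T} \<inter> {s. t \<le> s \<and> s < t + h}) \<le> card {t..<t + h}"
    by (intro card_mono) auto
  finally show ?thesis by simp
qed

lemma finite_line_kept: "finite {w. line_kept e s w}"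
proof (rule finite_subset)
  obtain u v t d where "e = (u, v, t, d)" by (cases e)
  then show "{w. line_kept e s w} \<subseteq> {fst e..fst (snd e)}" by (auto simp: line_kept_def)
qed simp

text \<open>Scale \<open>j\<close> has at most \<open>l div d ^ j + 4\<close> columns; held for
  \<open>d ^ j\<close> they cost at most \<open>5 * l\<close>. The coarsest scale costs that, each
  of \<open>d + 2\<close> finer ones a \<open>d\<close>-th part of it, together at most
  \<open>10 * l\<close>.\<close>

lemma line_cost:
  assumes d: "2 \<le> d" and uv: "u \<le> v"
  shows "(\<Sum>s<T. card {w. line_kept (u, v, t, d) s w}) \<le> 15 * (v - u)"
proof (cases "u < v")
  case False
  then show ?thesis by (simp add: line_kept_def)
next
  case True
  define l i where "l = v - u" and "i = level d l"
  define W where "W j = {w. u \<le> w \<and> w \<le> v \<and> (w = u \<or> w = v \<or> d ^ j dvd w)}" for j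
  have l: "1 \<le> l" using True by (simp add: l_def)
  have i: "d ^ i \<le> l" unfolding i_def using level(1)[OF d l] .
  have pos: "0 < d ^ j" for j using d by simp
  have W: "finite (W j)" "card (W j) \<le> l div d ^ j + 4" for j
    using card_multiples_le[OF pos uv, of j] unfolding W_def l_def by blast+
  have summand: "d ^ j * card (W j) \<le> 5 * l" if "j \<le> i" for j
  proof -
    have "d ^ j * card (W j) \<le> d ^ j * (l div d ^ j + 4)" by (intro mult_le_mono2 W)
    also have "\<dots> = d ^ j * (l div d ^ j) + 4 * d ^ j" by (simp add: algebra_simps)
    also have "d ^ j * (l div d ^ j) \<le> l" by simp
    also have "d ^ j \<le> d ^ i" using that d by (intro power_increasing) simp_all
    finally show ?thesis using i by linarith
  qed
  have "card {w. line_kept (u, v, t, d) s w} \<le>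
      (\<Sum>j\<le>i. if t \<le> s \<and> s < t + hold d i j then card (W j) else 0)" for s
  proof -
    let ?J = "{j. j \<le> i \<and> t \<le> s \<and> s < t + hold d i j}"
    have fin: "finite ?J" by simp
    have "{w. line_kept (u, v, t, d) s w} \<subseteq> (\<Union>j\<in>?J. W j)"
      by (auto simp: line_kept_def W_def i_def l_def)
    then have "card {w. line_kept (u, v, t, d) s w} \<le> card (\<Union>j\<in>?J. W j)"
      using W(1) by (intro card_mono) auto
    also have "\<dots> \<le> (\<Sum>j\<in>?J. card (W j))" by (rule card_UN_le[OF fin])
    also have "\<dots> = (\<Sum>j\<le>i. if t \<le> s \<and> s < t + hold d i j then card (W j) else 0)"
      by (intro sum.mono_neutral_cong_left) auto
    finally show ?thesis .
  qed
  then have "(\<Sum>s<T. card {w. line_kept (u, v, t, d) s w}) \<le>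
      (\<Sum>s<T. \<Sum>j\<le>i. if t \<le> s \<and> s < t + hold d i j then card (W j) else 0)"
    by (rule sum_mono)
  also have "\<dots> = (\<Sum>j\<le>i. \<Sum>s<T. if t \<le> s \<and> s < t + hold d i j then card (W j) else 0)"
    by (rule sum.swap)
  also have "\<dots> \<le> (\<Sum>j\<le>i. hold d i j * card (W j))" by (intro sum_mono sum_window_le)
  also have "\<dots> = (\<Sum>j<i. hold d i j * card (W j)) + d ^ i * card (W i)"
    by (simp add: hold_def flip: lessThan_Suc_atMost)
  also have "\<dots> \<le> 10 * l + 5 * l"
  proof (rule add_mono)
    let ?J = "{i - (d + 2)..<i}"
    \<comment> \<open>Multiplying by \<open>d\<close> absorbs the rounding in
      \<open>d ^ j div d\<close>.\<close>
    have "d * (\<Sum>j<i. hold d i j * card (W j)) = (\<Sum>j<i. d * (hold d i j * card (W j)))"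
      by (rule sum_distrib_left)
    also have "\<dots> \<le> (\<Sum>j<i. if j \<in> ?J then 5 * l else 0)"
    proof (rule sum_mono)
      fix j assume j: "j \<in> {..<i}"
      show "d * (hold d i j * card (W j)) \<le> (if j \<in> ?J then 5 * l else 0)"
      proof (cases "j \<in> ?J")
        case True
        have "d * (hold d i j * card (W j)) \<le> d * ((d ^ j div d) * card (W j))"
          using j by (intro mult_le_mono2 mult_le_mono1) (simp add: hold_def)
        also have "\<dots> = d * (d ^ j div d) * card (W j)" by simp
        also have "\<dots> \<le> d ^ j * card (W j)" by (intro mult_le_mono1) simp
        also have "\<dots> \<le> 5 * l" using j by (intro summand) simp
        finally show ?thesis using True by simp
      next
        case False
        then have "hold d i j = 0" using j by (auto simp: hold_def)
        then show ?thesis by simp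
      qed
    qed
    also have "\<dots> = (\<Sum>j\<in>{..<i} \<inter> ?J. 5 * l)" by (rule sum.inter_restrict[symmetric]) simp
    also have "\<dots> = card ({..<i} \<inter> ?J) * (5 * l)" by simp
    also have "\<dots> \<le> (d + 2) * (5 * l)"
    proof (rule mult_le_mono1)
      have "card ({..<i} \<inter> ?J) \<le> card ?J" by (intro card_mono) auto
      then show "card ({..<i} \<inter> ?J) \<le> d + 2" by simp
    qed
    also have "\<dots> \<le> (2 * d) * (5 * l)" using d by (intro mult_le_mono1) simp
    also have "\<dots> = d * (10 * l)" by simp
    finally show "(\<Sum>j<i. hold d i j * card (W j)) \<le> 10 * l" using d by simp
    show "d ^ i * card (W i) \<le> 5 * l" by (rule summand) simp
  qed
  finally show ?thesis by (simp add: l_def)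
qed

context instance_size
begin

section \<open>Bounding the solution by services, lines and guards\<close>

definition lines :: "entry list \<Rightarrow> nat \<Rightarrow> nat set" where
  "lines es s = {w. \<exists>e\<in>set es. line_kept e s w}"

definition guard_keys :: "entry list \<Rightarrow> nat \<Rightarrow> (nat \<times> nat \<times> nat) set" where
  "guard_keys es s = {(d, j, q). \<exists>e\<in>set es. guard_on v0 e s d j q}"

lemma finite_lines: "finite (lines es s)"
proof -
  have "lines es s = (\<Union>e\<in>set es. {w. line_kept e s w})" by (auto simp: lines_def)
  then show ?thesis by (simp add: finite_line_kept)
qed

text \<open>The guard of a key is the least available column from its threshold on, hence a function
  of the key, and guards can be counted by keys. \<open>es'\<close> will be the final entry list;
  \<open>t \<le> s\<close> in \<open>line_kept\<close> and \<open>guard_on\<close> keeps later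
  requests from counting at earlier ticks.\<close>

lemma keep_subset_image:
  assumes "set es \<subseteq> set es'"
  shows "keep v0 es s X \<subseteq> {v0} \<union> lines es' s \<union>
    (\<lambda>(d, j, q). LEAST c. c \<in> X \<and> d ^ j * (q - 2) \<le> c) ` guard_keys es' s"
proof
  let ?f = "\<lambda>(d, j, q). LEAST c. c \<in> X \<and> d ^ j * (q - 2) \<le> c"
  fix c assume "c \<in> keep v0 es s X"
  then consider "c = v0" | e where "e \<in> set es" "line_kept e s c"
    | e d j q where "e \<in> set es" "guard_on v0 e s d j q" "c \<in> X" "d ^ j * (q - 2) \<le> c"
      "\<forall>w\<in>X. d ^ j * (q - 2) \<le> w \<longrightarrow> c \<le> w"
    unfolding keep_def by blast
  then show "c \<in> {v0} \<union> lines es' s \<union> ?f ` guard_keys es' s"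
  proof cases
    case 2
    then show ?thesis using assms by (auto simp: lines_def)
  next
    case 3
    have "(LEAST c. c \<in> X \<and> d ^ j * (q - 2) \<le> c) = c"
      using 3(3-5) by (intro Least_equality) simp_all
    moreover have "(d, j, q) \<in> guard_keys es' s" using 3(1,2) assms by (auto simp: guard_keys_def)
    ultimately show ?thesis by (intro UnI2 image_eqI[of _ _ "(d, j, q)"]) simp_all
  qed simp
qed

lemma card_keep_le:
  assumes "set es \<subseteq> set es'" "finite (guard_keys es' s)"
  shows "finite (keep v0 es s X)" "card (keep v0 es s X) \<le> 1 + card (lines es' s) + card (guard_keys es' s)"
proof -
  let ?f = "\<lambda>(d, j, q). LEAST c. c \<in> X \<and> d ^ j * (q - 2) \<le> c"
  have fin: "finite ({v0} \<union> lines es' s \<union> ?f ` guard_keys es' s)" using assms(2) finite_lines by simp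
  then show "finite (keep v0 es s X)" using keep_subset_image[OF assms(1)] by (rule finite_subset[rotated])
  have "card (keep v0 es s X) \<le> card ({v0} \<union> lines es' s \<union> ?f ` guard_keys es' s)"
    using fin keep_subset_image[OF assms(1)] by (rule card_mono)
  also have "\<dots> \<le> card ({v0} \<union> lines es' s) + card (?f ` guard_keys es' s)" by (rule card_Un_le)
  also have "card ({v0} \<union> lines es' s) \<le> card {v0} + card (lines es' s)" by (rule card_Un_le)
  also have "card (?f ` guard_keys es' s) \<le> card (guard_keys es' s)" by (rule card_image_le[OF assms(2)])
  finally show "card (keep v0 es s X) \<le> 1 + card (lines es' s) + card (guard_keys es' s)" by simp
qed

definition tick_cost :: "entry list \<Rightarrow> event \<Rightarrow> nat" where
  "tick_cost es e = (case e of Tick s \<Rightarrow> 1 + card (lines es s) + card (guard_keys es s) | Request r \<Rightarrow> 0)"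

lemma tick_cost_Request: "tick_cost es (Request r) = 0"
  by (simp add: tick_cost_def)

lemma card_G_le:
  assumes "set (E p) \<subseteq> set es" "\<And>s. finite (guard_keys es s)"
  shows "card (G p) \<le> (\<Sum>e\<leftarrow>E p. fst (snd e) - fst e) + (\<Sum>e\<leftarrow>p. tick_cost es e)"
  using assms(1)
proof (induction p rule: rev_induct)
  case (snoc e p)
  show ?case
  proof (cases e)
    case (Request r)
    obtain v t where r: "r = (v, t)" by (cases r)
    let ?N = "hor ` ({nearest (S p) v..<v} \<times> {t}) \<inter> horizontal_edges n t"
    have "card (G (p @ [e])) \<le> card (G p) + card ?N"
      unfolding Request r G_Request by (rule card_Un_le)
    also have "card ?N \<le> card (hor ` ({nearest (S p) v..<v} \<times> {t}))" by (intro card_mono) auto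
    also have "\<dots> \<le> card ({nearest (S p) v..<v} \<times> {t})" by (rule card_image_le) simp
    also have "\<dots> = v - nearest (S p) v" by (simp add: card_cartesian_product)
    also have "card (G p) \<le> (\<Sum>e\<leftarrow>E p. fst (snd e) - fst e) + (\<Sum>e\<leftarrow>p. tick_cost es e)"
      using snoc by (auto simp: Request r E_Request)
    finally show ?thesis by (simp add: Request r E_Request tick_cost_Request)
  next
    case (Tick s)
    let ?N = "ver ` (keep v0 (E p) s (S p) \<times> {s}) \<inter> arcs n s"
    have sub: "set (E p) \<subseteq> set es" using snoc.prems by (simp add: Tick E_Tick)
    let ?k = "keep v0 (E p) s (S p)"
    note k = card_keep_le[OF sub assms(2), of s "S p"]
    have "card ?N \<le> card (ver ` (?k \<times> {s}))" using k(1) by (intro card_mono) auto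
    also have "\<dots> \<le> card (?k \<times> {s})" using k(1) by (intro card_image_le) simp
    also have "\<dots> = card ?k" by (simp add: card_cartesian_product)
    also have "\<dots> \<le> tick_cost es e" using k(2) by (simp add: Tick tick_cost_def)
    finally have "card ?N \<le> tick_cost es e" .
    moreover have "card (G (p @ [e])) \<le> card (G p) + card ?N"
      unfolding Tick G_Tick by (rule card_Un_le)
    moreover have "card (G p) \<le> (\<Sum>e\<leftarrow>E p. fst (snd e) - fst e) + (\<Sum>e\<leftarrow>p. tick_cost es e)"
      using snoc.IH[OF sub] .
    ultimately show ?thesis by (simp add: Tick E_Tick)
  qed
qed simp

lemma sum_tick_cost:
  assumes "ordered rs" "m \<le> length rs"
  shows "(\<Sum>e\<leftarrow>events 0 (take m rs). tick_cost es e) =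
    (\<Sum>s<end_time 0 (take m rs). tick_cost es (Tick s))"
  using assms(2)
proof (induction m)
  case (Suc m)
  then have m: "m < length rs" by simp
  define a b where "a = end_time 0 (take m rs)" and "b = snd (rs ! m)"
  have ab: "a \<le> b" using end_time_le[OF assms(1) m] by (simp add: a_def b_def)
  have "(\<Sum>e\<leftarrow>events 0 (take (Suc m) rs). tick_cost es e) =
      (\<Sum>s<a. tick_cost es (Tick s)) + (\<Sum>s\<leftarrow>[a..<b]. tick_cost es (Tick s))"
    using Suc m unfolding events_take_Suc[OF m] before_def
    by (simp add: tick_cost_Request a_def b_def comp_def)
  also have "(\<Sum>s\<leftarrow>[a..<b]. tick_cost es (Tick s)) = (\<Sum>s\<in>{a..<b}. tick_cost es (Tick s))"
    by (simp add: interv_sum_list_conv_sum_set_nat)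
  also have "(\<Sum>s<a. tick_cost es (Tick s)) + \<dots> = (\<Sum>s<b. tick_cost es (Tick s))"
    using sum.atLeastLessThan_concat[of 0 a b] ab by (simp add: atLeast0LessThan)
  also have "b = end_time 0 (take (Suc m) rs)"
    using m by (simp add: take_Suc_conv_app_nth end_time_snoc b_def)
  finally show ?case .
qed (simp add: end_time_def)

lemma card_solution_le:
  assumes rs: "ordered rs" and F: "feasible n v0 rs F"
  shows "card (solution alg n v0 rs) \<le> (312 * \<Sum>(phase_base n ` {..<length rs}) + 1) * card F"
proof -
  define N where "N = length rs"
  define u v t where "u k = fst (entry rs k)" and "v k = fst (rs ! k)" and "t k = snd (rs ! k)" for k
  define es where "es = map (entry rs) [0..<N]"
  define D where "D = phase_base n ` {..<N}"
  define K where "K d = {k. k < N \<and> phase_base n k = d \<and> u k < v k}" for d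
  define T where "T = end_time 0 rs"
  have finF: "finite F" and sub: "F \<subseteq> timeline_edges n"
    and reach: "\<And>r. r \<in> set rs \<Longrightarrow> ((v0, 0), r) \<in> F\<^sup>*"
    using F by (auto simp: feasible_def)
  have entry: "entry rs k = (u k, v k, t k, phase_base n k)" for k
    by (simp add: entry_def u_def v_def t_def)
  have uv: "u k \<le> v k" "v0 \<le> u k" "v k \<le> n" if "k < N" for k
    using entry_bounds[OF rs, of k] that rs nth_mem[of k rs]
    by (auto simp: u_def v_def N_def ordered_def)
  have ph: "phase d v0 n F (K d) u v t" if "d \<in> D" for d
  proof
    show "2 \<le> d" using that phase_base_ge_2 by (auto simp: D_def)
    show "finite F" "F \<subseteq> timeline_edges n" "finite (K d)" using finF sub by (simp_all add: K_def)
  next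
    fix k assume "k \<in> K d"
    then show "v0 \<le> u k \<and> u k < v k" "((v0, 0), (v k, t k)) \<in> F\<^sup>*"
      using uv[of k] reach[OF nth_mem, of k] by (auto simp: K_def v_def t_def N_def)
  next
    fix k1 k2 w j assume k: "k1 \<in> K d" "k2 \<in> K d" "k1 < k2"
      and a: "u k1 \<le> w" "w \<le> v k1" "w = u k1 \<or> w = v k1 \<or> d ^ j dvd w"
        "j \<le> level d (v k1 - u k1)" "t k2 \<le> t k1 + hold d (level d (v k1 - u k1)) j" "w \<le> v k2"
    have k': "k2 < length rs" "phase_base n k1 = d" "u k1 < v k1" using k by (auto simp: K_def N_def)
    have "w \<in> S (before rs k2)"
      using line_available[OF rs k(3) k'(1), of w j] a k'(2,3) by (simp add: u_def v_def t_def)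
    then show "w \<le> u k2" using entry_bounds(3)[OF rs k'(1)] a(6) by (simp add: u_def v_def)
  next
    fix k1 k2 j assume k: "k1 \<in> K d" "k2 \<in> K d" "k1 < k2"
      and a: "v k1 - v0 \<le> d ^ j * d ^ (d + 2)" "t k2 \<le> t k1 + d ^ j"
    have k': "k2 < length rs" "phase_base n k1 = d" "u k1 < v k1" using k by (auto simp: K_def N_def)
    have "\<exists>c\<in>S (before rs k2). d ^ j * (v k1 div d ^ j - 2) \<le> c \<and>
        c \<le> max (u k1) (d ^ j * (v k1 div d ^ j - 2))"
      using guard_available[OF rs k(3) k'(1), of "d ^ j" j] a k'(2,3) by (simp add: u_def v_def t_def)
    then show "\<exists>c. d ^ j * (v k1 div d ^ j - 2) \<le> c \<and>
        c \<le> max (u k1) (d ^ j * (v k1 div d ^ j - 2)) \<and> (c \<le> v k2 \<longrightarrow> c \<le> u k2)"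
      using entry_bounds(3)[OF rs k'(1)] by (auto simp: u_def v_def)
  next
    fix k1 k2 assume "k1 \<in> K d" "k2 \<in> K d" "k1 < k2"
    then show "t k1 \<le> t k2"
      using rs sorted_nth_mono[of "map snd rs" k1 k2] by (simp add: ordered_def K_def N_def t_def)
  qed
  have finD: "finite D" by (simp add: D_def)
  \<comment> \<open>If \<open>n\<close> exceeds \<open>d ^ d\<close>, base \<open>d\<close> is
    assigned only to requests with index below \<open>d ^ d\<close>.\<close>
  have small: "card (K d) \<le> d ^ d \<or> (\<forall>k\<in>K d. v k - v0 \<le> d ^ d)" for d
  proof (cases "n \<le> d ^ d")
    case True
    then show ?thesis using uv(3) by (fastforce simp: K_def)
  next
    case False
    have "K d \<subseteq> {..<d ^ d}"
    proof
      fix k assume "k \<in> K d"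
      moreover obtain p where "phase_base n k = 2 ^ p" "k < (2 ^ p) ^ (2 ^ p) \<or> n \<le> (2 ^ p) ^ (2 ^ p)"
        by (rule phase_base)
      ultimately show "k \<in> {..<d ^ d}" using False by (auto simp: K_def)
    qed
    from card_mono[OF _ this] show ?thesis by simp
  qed
  have lens: "(\<Sum>k<N. v k - u k) \<le> 18 * \<Sum>D * card F"
  proof -
    have "(\<Sum>k<N. v k - u k) = (\<Sum>k\<in>{k. k < N \<and> u k < v k}. v k - u k)"
      by (rule sum.mono_neutral_right) auto
    also have "\<dots> = (\<Sum>d\<in>D. \<Sum>k\<in>{x \<in> {k. k < N \<and> u k < v k}. phase_base n x = d}. v k - u k)"
      by (rule sum.group[symmetric]) (auto simp: D_def)
    also have "\<dots> = (\<Sum>d\<in>D. \<Sum>k\<in>K d. v k - u k)"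
      by (intro sum.cong refl) (auto simp: K_def)
    also have "\<dots> \<le> (\<Sum>d\<in>D. 18 * d * card F)"
      using phase.sum_length[OF ph small] by (rule sum_mono)
    also have "\<dots> = 18 * \<Sum>D * card F" by (simp add: sum_distrib_left sum_distrib_right)
    finally show ?thesis .
  qed
  define g where "g d s = phase.guards d v0 (K d) v t s" for d s
  have keys: "guard_keys es s \<subseteq> Sigma D (\<lambda>d. g d s)" for s
  proof
    fix x assume x: "x \<in> guard_keys es s"
    obtain d j q where dq: "x = (d, j, q)" by (cases x)
    from x obtain k where k: "k < N" "guard_on v0 (entry rs k) s d j q"
      by (auto simp: guard_keys_def es_def dq)
    then have d: "d \<in> D" "k \<in> K d" by (auto simp: guard_on_def entry D_def K_def)
    moreover have "(j, q) \<in> g d s"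
      using k(2) d(2) unfolding g_def phase.guards_def[OF ph[OF d(1)]] phase.guarded_def[OF ph[OF d(1)]]
      by (auto simp: guard_on_def entry)
    ultimately show "x \<in> Sigma D (\<lambda>d. g d s)" unfolding dq by blast
  qed
  have fing: "finite (g d s)" if "d \<in> D" for d s
    unfolding g_def by (rule phase.finite_guards[OF ph[OF that]])
  have finS: "finite (Sigma D (\<lambda>d. g d s))" for s using finD fing by (intro finite_SigmaI)
  have fink: "finite (guard_keys es s)" for s using keys finS by (rule finite_subset)
  have guards: "(\<Sum>s<T. card (guard_keys es s)) \<le> 24 * \<Sum>D * card F"
  proof -
    have "(\<Sum>s<T. card (guard_keys es s)) \<le> (\<Sum>s<T. \<Sum>d\<in>D. card (g d s))"
    proof (rule sum_mono)
      fix s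
      have "card (guard_keys es s) \<le> card (Sigma D (\<lambda>d. g d s))" using finS keys by (rule card_mono)
      also have "\<dots> = (\<Sum>d\<in>D. card (g d s))" using finD fing by (intro card_SigmaI) simp_all
      finally show "card (guard_keys es s) \<le> (\<Sum>d\<in>D. card (g d s))" .
    qed
    also have "\<dots> = (\<Sum>d\<in>D. \<Sum>s<T. card (g d s))" by (rule sum.swap)
    also have "\<dots> \<le> (\<Sum>d\<in>D. 24 * d * card F)"
      unfolding g_def using phase.sum_guards[OF ph] by (rule sum_mono)
    also have "\<dots> = 24 * \<Sum>D * card F" by (simp add: sum_distrib_left sum_distrib_right)
    finally show ?thesis .
  qed
  have lines: "(\<Sum>s<T. card (lines es s)) \<le> 15 * (\<Sum>k<N. v k - u k)"
  proof -
    have "(\<Sum>s<T. card (lines es s)) \<le> (\<Sum>s<T. \<Sum>k<N. card {w. line_kept (entry rs k) s w})"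
    proof (rule sum_mono)
      fix s
      have "lines es s = (\<Union>k<N. {w. line_kept (entry rs k) s w})"
        by (auto simp: lines_def es_def)
      then show "card (lines es s) \<le> (\<Sum>k<N. card {w. line_kept (entry rs k) s w})"
        using card_UN_le[of "{..<N}"] by simp
    qed
    also have "\<dots> = (\<Sum>k<N. \<Sum>s<T. card {w. line_kept (entry rs k) s w})" by (rule sum.swap)
    also have "\<dots> \<le> (\<Sum>k<N. 15 * (v k - u k))"
      unfolding entry using uv(1) by (intro sum_mono line_cost phase_base_ge_2) simp
    finally show ?thesis by (simp add: sum_distrib_left)
  qed
  have T: "T \<le> card F"
  proof (cases "rs = []")
    case False
    obtain w r where l: "last rs = (w, r)" by (cases "last rs")
    then have r: "r = T" using False by (simp add: T_def end_time_def)
    have p: "((v0, 0), (w, r)) \<in> F\<^sup>*" using reach[OF last_in_set[OF False]] l by simp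
    have "r - 0 \<le> card (Vs F)"
    proof (rule card_rows_le[OF finite_Vs[OF finF]])
      fix s assume "s \<in> {0..<r}"
      then have "s < r" by simp
      from reach_rows[OF p sub this] obtain w where "ver (w, s) \<in> F" .
      then show "\<exists>w. (w, s) \<in> Vs F" by (auto simp: Vs_def)
    qed
    then show ?thesis using card_Hs_Vs_le[OF finF] r by linarith
  qed (simp add: T_def end_time_def)
  have E: "E (events 0 rs) = es" using E_events[of N rs] by (simp add: es_def N_def)
  have "card (solution alg n v0 rs) \<le> (\<Sum>e\<leftarrow>es. fst (snd e) - fst e) + (\<Sum>e\<leftarrow>events 0 rs. tick_cost es e)"
    using card_G_le[of "events 0 rs" es] fink by (simp add: solution_def E)
  also have "(\<Sum>e\<leftarrow>es. fst (snd e) - fst e) = (\<Sum>k<N. v k - u k)"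
    by (simp add: es_def entry comp_def interv_sum_list_conv_sum_set_nat atLeast0LessThan)
  also have "(\<Sum>e\<leftarrow>events 0 rs. tick_cost es e) = (\<Sum>s<T. tick_cost es (Tick s))"
    using sum_tick_cost[OF rs, of N es] by (simp add: N_def T_def)
  also have "\<dots> = T + (\<Sum>s<T. card (lines es s)) + (\<Sum>s<T. card (guard_keys es s))"
    unfolding tick_cost_def event.case sum.distrib by simp
  finally have "card (solution alg n v0 rs) \<le>
      (\<Sum>k<N. v k - u k) + (card F + 15 * (\<Sum>k<N. v k - u k) + 24 * \<Sum>D * card F)"
    using T lines guards by linarith
  also have "\<dots> \<le> 16 * (18 * \<Sum>D * card F) + (card F + 24 * \<Sum>D * card F)"
    using lens by linarith
  also have "\<dots> = (312 * \<Sum>D + 1) * card F" by (simp add: algebra_simps)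
  finally show ?thesis by (simp add: D_def N_def)
qed

end

section \<open>The upper bound\<close>

lemma one_less_ln:
  assumes "3 \<le> x" shows "1 < ln (real x)"
proof -
  \<comment> \<open>At 1 the quadratic bound on \<open>exp\<close> gives only 3 itself; at 1/4 it
    gives \<open>(21 / 16) ^ 4 < 3\<close>.\<close>
  have "exp (1::real) = exp (1 / 4) ^ 4" by (simp flip: exp_of_nat_mult)
  also have "\<dots> \<le> (1 + 1 / 4 + (1 / 4)\<^sup>2) ^ 4" by (intro power_mono exp_bound) simp_all
  also have "\<dots> < (3::real)" by (simp add: power_divide eval_nat_numeral)
  also have "\<dots> \<le> real x" using assms by simp
  finally have "ln (exp 1) < ln (real x)" using assms by (subst ln_less_cancel_iff) simp_all
  then show ?thesis by simp
qed

lemma log_over_loglog_ge_1: "1 \<le> log_over_loglog x"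
proof (cases "x < 3")
  case False
  then have y: "1 < ln (real x)" by (intro one_less_ln) simp
  then have "0 < ln (ln (real x))" by simp
  moreover have "ln (ln (real x)) \<le> ln (real x) - 1" using y by (intro ln_le_minus_one) simp
  ultimately have "1 \<le> ln (real x) / ln (ln (real x))" by (subst pos_le_divide_eq) linarith+
  then show ?thesis using False by (simp add: log_over_loglog_def)
qed (simp add: log_over_loglog_def)

lemma dmcd_ratio_ge_1: "1 \<le> dmcd_ratio n N"
  by (simp add: dmcd_ratio_def log_over_loglog_ge_1)

text \<open>With \<open>y = ln x\<close>, the hypothesis says \<open>e * ln e \<le> y\<close>, and
  \<open>e * ln y \<le> 2 * y\<close> is needed. If \<open>y \<le> e ^ 2\<close>, then
  \<open>ln y \<le> 2 * ln e\<close>; otherwise \<open>e\<close> and \<open>ln y / 2\<close> are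
  both at most \<open>sqrt y\<close>.\<close>

lemma le_log_over_loglog:
  assumes "2 \<le> e" "e ^ e \<le> x"
  shows "real e \<le> 2 * log_over_loglog x"
proof -
  have "2 ^ 2 \<le> e ^ 2" using assms(1) by (intro power_mono) simp_all
  also have "e ^ 2 \<le> e ^ e" using assms(1) by (intro power_increasing) simp_all
  finally have x: "3 \<le> x" using assms(2) by simp
  define y where "y = ln (real x)"
  have y: "1 < y" using one_less_ln[OF x] by (simp add: y_def)
  then have z: "0 < ln y" by simp
  have "real e * ln (real e) = ln (real (e ^ e))" using assms(1) by (simp add: ln_realpow)
  also have "\<dots> \<le> y" unfolding y_def using assms(1) x of_nat_mono[OF assms(2), where 'a = real] by (subst ln_le_cancel_iff) simp_all
  finally have ey: "real e * ln (real e) \<le> y" .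
  have "real e * ln y \<le> 2 * y"
  proof (cases "y \<le> (real e)\<^sup>2")
    case True
    have "ln y \<le> ln ((real e)\<^sup>2)" using True y assms(1) by (subst ln_le_cancel_iff) simp_all
    also have "\<dots> = 2 * ln (real e)" using assms(1) by (simp add: ln_realpow)
    finally have "real e * ln y \<le> real e * (2 * ln (real e))" by (rule mult_left_mono) simp
    then show ?thesis using ey by simp
  next
    case False
    then have e: "real e \<le> sqrt y" by (intro real_le_rsqrt) simp
    have "ln y = 2 * ln (sqrt y)" using y by (simp add: ln_sqrt)
    also have "\<dots> \<le> 2 * sqrt y" using ln_le_minus_one[of "sqrt y"] y by simp
    finally have "real e * ln y \<le> sqrt y * (2 * sqrt y)" using e z y by (intro mult_mono) simp_all
    also have "\<dots> = 2 * y" using y by simp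
    finally show ?thesis .
  qed
  then have "real e \<le> 2 * y / ln y" using z by (simp add: pos_le_divide_eq)
  then show ?thesis using x by (simp add: log_over_loglog_def y_def)
qed

text \<open>By minimality, half the base, \<open>e\<close>, still has \<open>e ^ e \<le> k\<close>
  and \<open>e ^ e < n\<close>. Base 2 has no predecessor, but the ratio is at least 1.\<close>

lemma phase_base_le:
  assumes "k < N"
  shows "real (phase_base n k) \<le> 4 * dmcd_ratio n N"
proof -
  obtain p where p: "phase_base n k = 2 ^ p" "1 \<le> p"
    "\<And>q. 1 \<le> q \<Longrightarrow> q < p \<Longrightarrow> (2 ^ q) ^ (2 ^ q) \<le> k \<and> (2 ^ q) ^ (2 ^ q) < n"
    using phase_base[of n k] by metis
  show ?thesis
  proof (cases "p = 1")
    case True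
    then show ?thesis using p(1) dmcd_ratio_ge_1[of n N] by simp
  next
    case False
    then obtain q where q: "p = Suc q" "1 \<le> q" using p(2) by (cases p) auto
    define e :: nat where "e = 2 ^ q"
    have e: "2 \<le> e" using power_increasing[of 1 q "2::nat"] q(2) by (simp add: e_def)
    have "e ^ e \<le> k \<and> e ^ e < n" unfolding e_def using q by (intro p(3)) simp_all
    then have "e ^ e \<le> N" "e ^ e \<le> n" using assms by simp_all
    then have "real e \<le> 2 * dmcd_ratio n N"
      using le_log_over_loglog[OF e, of N] le_log_over_loglog[OF e, of n] by (simp add: dmcd_ratio_def)
    then show ?thesis using p(1) q(1) by (simp add: e_def)
  qed
qed

text \<open>Distinct powers of two sum to at most twice the largest.\<close>

lemma sum_phase_bases_le: "real (\<Sum>(phase_base n ` {..<N})) \<le> 8 * dmcd_ratio n N"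
proof (cases "N = 0")
  case True
  then show ?thesis using dmcd_ratio_ge_1[of n N] by simp
next
  case False
  let ?D = "phase_base n ` {..<N}"
  have D: "finite ?D" "?D \<noteq> {}" using False by auto
  obtain k where k: "k < N" "Max ?D = phase_base n k" using Max_in[OF D] by auto
  obtain m where m: "phase_base n k = 2 ^ m" by (rule phase_base[of n k])
  have "?D \<subseteq> (\<lambda>p. 2 ^ p) ` {..m}"
  proof
    fix d assume d: "d \<in> ?D"
    then obtain l where "d = phase_base n l" by blast
    then obtain p where p: "d = 2 ^ p" using phase_base[of n l] by metis
    have "d \<le> 2 ^ m" using Max_ge[OF D(1) d] k m by simp
    then have "p \<le> m" using p by simp
    then show "d \<in> (\<lambda>p. 2 ^ p) ` {..m}" using p by blast
  qed
  then have "\<Sum>?D \<le> \<Sum>((\<lambda>p. 2 ^ p) ` {..m})" by (intro sum_mono2) auto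
  also have "\<dots> = (\<Sum>p\<le>m. 2 ^ p)" by (subst sum.reindex) (auto simp: inj_on_def)
  also have "\<dots> \<le> 2 * 2 ^ m" by (induction m) auto
  finally have "real (\<Sum>?D) \<le> 2 * real (phase_base n k)" unfolding m by (metis of_nat_le_iff of_nat_mult of_nat_numeral)
  then show ?thesis using phase_base_le[OF k(1), of n] by linarith
qed

lemma opt_costE:
  assumes "feasible n v0 rs F"
  obtains F' where "feasible n v0 rs F'" "card F' = opt_cost n v0 rs"
proof -
  have "\<exists>F'. feasible n v0 rs F' \<and> card F' = opt_cost n v0 rs"
    unfolding opt_cost_def by (rule LeastI_ex) (use assms in blast)
  then show thesis using that by blast
qed

lemma opt_cost_le: "feasible n v0 rs F \<Longrightarrow> opt_cost n v0 rs \<le> card F"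
  unfolding opt_cost_def by (rule Least_le) blast

text \<open>The constant is \<open>312 * 8 + 1\<close>; the 1 is absorbed because the ratio is at
  least 1.\<close>

lemma competitive_alg: "competitive alg (\<lambda>n N. 2497 * dmcd_ratio n N)"
  unfolding competitive_def
proof (intro conjI allI impI online_alg; elim conjE)
  fix n v0 rs assume v0: "1 \<le> v0" "v0 \<le> n" and vi: "valid_input n v0 rs"
  interpret instance_size n v0 using v0 by unfold_locales
  obtain F0 where F0: "feasible n v0 rs F0" using vi by (auto simp: valid_input_def)
  have ord: "ordered rs"
    unfolding ordered_def
  proof (intro conjI ballI)
    show "sorted (map snd rs)" using vi by (simp add: valid_input_def)
    fix r assume r: "r \<in> set rs"
    obtain v t where vt: "r = (v, t)" by (cases r)
    show "v0 \<le> fst r" using reach_start_le[of v0 v t F0 n] F0 r by (simp add: feasible_def vt)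
    show "fst r \<le> n" using vi r by (auto simp: valid_input_def replicas_def vt)
  qed
  then show "feasible n v0 rs (solution alg n v0 rs)" by (rule feasible_alg)
  obtain F where F: "feasible n v0 rs F" "card F = opt_cost n v0 rs" using opt_costE[OF F0] .
  let ?D = "\<Sum>(phase_base n ` {..<length rs})"
  have "real (card (solution alg n v0 rs)) \<le> real ((312 * ?D + 1) * card F)"
    using card_solution_le[OF ord F(1)] by (rule of_nat_mono)
  also have "\<dots> = (312 * real ?D + 1) * real (opt_cost n v0 rs)" by (simp only: F(2) of_nat_mult of_nat_add of_nat_numeral of_nat_1)
  also have "\<dots> \<le> (2497 * dmcd_ratio n (length rs)) * real (opt_cost n v0 rs)"
    using sum_phase_bases_le[of n "length rs"] dmcd_ratio_ge_1[of n "length rs"]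
    by (intro mult_right_mono) linarith+
  finally show "real (card (solution alg n v0 rs)) \<le>
    2497 * dmcd_ratio n (length rs) * real (opt_cost n v0 rs)" .
qed

section \<open>The adversary\<close>

lemma arc_decided:
  assumes A: "online_algorithm A" and w: "ver (w, s) \<in> run A n v0 past F es"
    and es: "\<And>e. e \<in> set es \<Longrightarrow> (\<exists>r. e = Request r) \<or> (\<exists>x>s. e = Tick x)"
  shows "ver (w, s) \<in> F"
  using w es
proof (induction es arbitrary: past F)
  case (Cons e es)
  have "ver (w, s) \<in> F \<union> A n v0 past e F"
    using Cons.IH[of "past @ [e]" "F \<union> A n v0 past e F"] Cons.prems by simp
  moreover have "ver (w, s) \<notin> allowed n e"
  proof -
    consider r where "e = Request r" | x where "e = Tick x" "s < x"
      using Cons.prems(2)[of e] by auto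
    then show ?thesis
    proof cases
      case 1
      then show ?thesis using hor_neq_ver[symmetric] by (auto simp: horizontal_edges_hor)
    next
      case 2
      then show ?thesis by (auto simp: arcs_ver ver_def)
    qed
  qed
  moreover have "A n v0 past e F \<subseteq> allowed n e" using A unfolding online_algorithm_def by blast
  ultimately show ?case by blast
qed simp

lemma events_ticks:
  assumes "sorted (map snd rs)" "\<And>r. r \<in> set rs \<Longrightarrow> a \<le> snd r" "e \<in> set (events a rs)"
  shows "(\<exists>r. e = Request r) \<or> (\<exists>x\<ge>a. e = Tick x)"
  using assms
proof (induction rs arbitrary: a)
  case (Cons r rs)
  consider "e \<in> Tick ` {a..<snd r}" | "e = Request r" | "e \<in> set (events (snd r) rs)"
    using Cons.prems(3) by auto
  then show ?case
  proof cases
    case 3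
    have "(\<exists>r. e = Request r) \<or> (\<exists>x\<ge>snd r. e = Tick x)"
      using Cons.prems(1) 3 by (intro Cons.IH) auto
    then show ?thesis using Cons.prems(2)[of r] by auto
  qed auto
qed simp

lemma run_append: "run A n v0 past F (es @ fs) = run A n v0 (past @ es) (run A n v0 past F es) fs"
  by (induction es arbitrary: past F) auto

definition decided :: "algorithm \<Rightarrow> nat \<Rightarrow> nat \<Rightarrow> replica list \<Rightarrow> nat \<Rightarrow> edge set" where
  "decided A n v0 rs s = run A n v0 [] {} (events 0 rs @ map Tick [end_time 0 rs..<s])"

text \<open>The arcs leaving time \<open>s\<close> are fixed at tick \<open>s\<close>, before any
  later request is seen. The adversary can thus choose later requests from these arcs without
  changing them.\<close>

lemma solution_arc_iff:
  assumes A: "online_algorithm A" and rs: "sorted (map snd (rs @ rs'))" "rs' \<noteq> []"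
    and time: "\<And>r. r \<in> set rs' \<Longrightarrow> s < snd r" "end_time 0 rs \<le> s"
  shows "ver (w, s) \<in> solution A n v0 (rs @ rs') \<longleftrightarrow> ver (w, s) \<in> decided A n v0 rs (Suc s)"
proof -
  let ?e = "end_time 0 rs"
  obtain r rs'' where r: "rs' = r # rs''" using rs(2) by (cases rs') auto
  have "events ?e rs' = map Tick [?e..<Suc s] @ events (Suc s) rs'"
  proof -
    have "Suc s \<le> snd r" using time(1)[of r] r by simp
    then obtain k where "snd r = Suc s + k" using le_Suc_ex by blast
    then have "[?e..<snd r] = [?e..<Suc s] @ [Suc s..<snd r]"
      using time(2) upt_add_eq_append[of ?e "Suc s" k] by (simp del: upt_Suc)
    then show ?thesis unfolding r by (simp del: upt_Suc)
  qed
  then have sol: "solution A n v0 (rs @ rs') =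
      run A n v0 (events 0 rs @ map Tick [?e..<Suc s]) (decided A n v0 rs (Suc s)) (events (Suc s) rs')"
    by (simp add: solution_def decided_def events_append run_append)
  show ?thesis
  proof
    assume "ver (w, s) \<in> solution A n v0 (rs @ rs')"
    then show "ver (w, s) \<in> decided A n v0 rs (Suc s)"
      unfolding sol
    proof (rule arc_decided[OF A])
      fix e assume "e \<in> set (events (Suc s) rs')"
      then have "(\<exists>r. e = Request r) \<or> (\<exists>x\<ge>Suc s. e = Tick x)"
        using rs(1) time(1) by (intro events_ticks) (auto simp: sorted_append Suc_le_eq)
      then show "(\<exists>r. e = Request r) \<or> (\<exists>x>s. e = Tick x)" by (auto simp: Suc_le_eq)
    qed
  next
    assume "ver (w, s) \<in> decided A n v0 rs (Suc s)"
    then show "ver (w, s) \<in> solution A n v0 (rs @ rs')"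
      unfolding sol using run_mono[of A n v0 _ _ "[]"] by fastforce
  qed
qed

text \<open>The path enters row \<open>s + 1\<close> by an arc and can only move right within that
  row.\<close>

lemma reach_row_entry:
  assumes "((v0, 0), p) \<in> F\<^sup>*" "F \<subseteq> timeline_edges n" "snd p = Suc s"
  shows "\<exists>w\<le>fst p. ver (w, s) \<in> F \<and> (\<forall>x. w \<le> x \<and> x < fst p \<longrightarrow> hor (x, Suc s) \<in> F)"
  using assms(1,3)
proof (induction rule: rtrancl_induct)
  case (step p q)
  obtain v t where p: "p = (v, t)" by (cases p)
  from step.hyps(2) assms(2) show ?case
  proof (cases rule: timeline_edges_cases)
    case 1
    then have q: "q = (Suc v, Suc s)" and t: "t = Suc s" using step.prems by (simp_all add: p)
    obtain w where w: "w \<le> v" "ver (w, s) \<in> F"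
      "\<forall>x. w \<le> x \<and> x < v \<longrightarrow> hor (x, Suc s) \<in> F"
      using step.IH t unfolding p fst_conv snd_conv by (elim meta_impE exE conjE) simp_all
    have "hor (x, Suc s) \<in> F" if x: "w \<le> x" "x < Suc v" for x
    proof (cases "x = v")
      case True then show ?thesis using 1(1) p t by simp
    next
      case False
      then have "w \<le> x \<and> x < v" using x by simp
      then show ?thesis by (rule w(3)[rule_format])
    qed
    then show ?thesis unfolding q fst_conv using w(1,2) by (intro exI[of _ w] conjI allI impI) simp_all
  next
    case 2
    then have "q = (v, Suc s)" "ver (v, s) \<in> F" using step.prems by (simp_all add: p)
    then show ?thesis by (intro exI[of _ v]) auto
  qed
qed simp

lemma sum_card_rows_le:
  fixes P :: "(nat \<times> nat) set"
  assumes "finite P" "inj_on f {..<T :: nat}"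
  shows "(\<Sum>s<T. card {w. (w, f s) \<in> P}) \<le> card P"
proof -
  have fin: "finite {w. (w, f s) \<in> P}" for s
    by (rule finite_subset[OF _ finite_imageI[OF assms(1), of fst]]) force
  have "(\<Sum>s<T. card {w. (w, f s) \<in> P}) = card (Sigma {..<T} (\<lambda>s. {w. (w, f s) \<in> P}))"
    using fin by (simp add: card_SigmaI)
  also have "\<dots> = card ((\<lambda>(s, w). (w, f s)) ` Sigma {..<T} (\<lambda>s. {w. (w, f s) \<in> P}))"
    using assms(2) by (intro card_image[symmetric]) (auto simp: inj_on_def)
  also have "\<dots> \<le> card P" using assms(1) by (intro card_mono) auto
  finally show ?thesis .
qed

text \<open>\<open>V t\<close> is the frontier at time \<open>t\<close>, for \<open>t \<le> D\<close>.\<close>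

locale diagonal =
  fixes A :: algorithm and n L :: nat
  assumes online: "online_algorithm A" and L: "1 \<le> L"
begin

abbreviation d :: nat where "d \<equiv> Suc L"

text \<open>Both the number of steps and the initial lead of the frontier. No strike lies further
  than \<open>D\<close> behind the frontier, so none falls left of the origin 1, and reaching the
  initial frontier costs no more than the \<open>D\<close> steps.\<close>

definition D :: nat where "D = d ^ L"

definition V :: "nat \<Rightarrow> nat" where "V t = 1 + D + t"

text \<open>No copy is stored from time \<open>s\<close> to \<open>s + 1\<close> in level \<open>i\<close> behind the frontier.\<close>

definition gap :: "edge set \<Rightarrow> nat \<Rightarrow> nat \<Rightarrow> bool" where
  "gap F s i \<longleftrightarrow> (\<forall>w. V (Suc s) < w + d ^ Suc i \<and> w + d ^ i \<le> V (Suc s) \<longrightarrow> ver (w, s) \<notin> F)"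

definition strikes :: "nat \<Rightarrow> nat option \<Rightarrow> replica list" where
  "strikes s x = (case x of None \<Rightarrow> [] | Some i \<Rightarrow> [(V (Suc s) - d ^ i, Suc s)])"

definition strike_level :: "edge set \<Rightarrow> nat \<Rightarrow> nat option" where
  "strike_level F s = (if \<exists>i<L. gap F s i then Some (SOME i. i < L \<and> gap F s i) else None)"

lemma strike_level: "case strike_level F s of None \<Rightarrow> \<forall>i<L. \<not> gap F s i | Some i \<Rightarrow> i < L \<and> gap F s i"
  using someI_ex[of "\<lambda>i. i < L \<and> gap F s i"] by (auto simp: strike_level_def)

primrec adversary :: "nat \<Rightarrow> replica list" where
  "adversary 0 = []"
| "adversary (Suc s) = adversary s @ strikes s (strike_level (decided A n 1 (adversary s) (Suc s)) s)"

definition requests :: "(nat \<Rightarrow> nat option) \<Rightarrow> nat \<Rightarrow> replica list" where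
  "requests \<sigma> T = concat (map (\<lambda>s. strikes s (\<sigma> s)) [0..<T])"

lemma set_strikes: "r \<in> set (strikes s x) \<Longrightarrow> snd r = Suc s"
  by (auto simp: strikes_def split: option.splits)

lemma times_requests: "r \<in> set (requests \<sigma> T) \<Longrightarrow> 1 \<le> snd r \<and> snd r \<le> T"
  by (auto simp: requests_def dest: set_strikes)

lemma sorted_requests: "sorted (map snd (requests \<sigma> T))"
proof (induction T)
  case (Suc T)
  have "requests \<sigma> (Suc T) = requests \<sigma> T @ strikes T (\<sigma> T)" by (simp add: requests_def)
  moreover have "sorted (map snd (strikes T (\<sigma> T)))" by (simp add: strikes_def split: option.split)
  ultimately show ?case using Suc times_requests[of _ \<sigma> T]
    by (fastforce simp: sorted_append dest: set_strikes)
qed (simp add: requests_def)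

lemma length_requests: "length (requests \<sigma> T) \<le> T"
proof (induction T)
  case (Suc T)
  have "requests \<sigma> (Suc T) = requests \<sigma> T @ strikes T (\<sigma> T)" by (simp add: requests_def)
  moreover have "length (strikes T (\<sigma> T)) \<le> 1" by (simp add: strikes_def split: option.split)
  ultimately show ?case using Suc by simp
qed (simp add: requests_def)

text \<open>The final request on the frontier is repeated to reach a prescribed number of requests.\<close>

definition input :: "(nat \<Rightarrow> nat option) \<Rightarrow> nat \<Rightarrow> replica list" where
  "input \<sigma> m = requests \<sigma> D @ replicate m (V D, D)"

lemma sorted_input: "sorted (map snd (input \<sigma> m))"
  using sorted_requests[of \<sigma> D] times_requests[of _ \<sigma> D] by (auto simp: input_def sorted_append)

text \<open>The choices are made from partial runs but hold of the final solution by
  \<open>solution_arc_iff\<close>; \<open>1 \<le> m\<close> ensures a request at time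
  \<open>D\<close>, so tick \<open>s\<close> occurs. One \<open>\<sigma>\<close> works for all
  \<open>m\<close>, so the number of requests can be adjusted afterwards.\<close>

lemma adversary:
  obtains \<sigma> where "\<And>m s. 1 \<le> m \<Longrightarrow> s < D \<Longrightarrow> case \<sigma> s of
    None \<Rightarrow> \<forall>i<L. \<not> gap (solution A n 1 (input \<sigma> m)) s i
  | Some i \<Rightarrow> i < L \<and> gap (solution A n 1 (input \<sigma> m)) s i"
proof -
  define \<sigma> where "\<sigma> s = strike_level (decided A n 1 (adversary s) (Suc s)) s" for s
  have adv: "adversary T = requests \<sigma> T" for T
    by (induction T) (simp_all add: requests_def \<sigma>_def)
  have "case \<sigma> s of
    None \<Rightarrow> \<forall>i<L. \<not> gap (solution A n 1 (input \<sigma> m)) s i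
  | Some i \<Rightarrow> i < L \<and> gap (solution A n 1 (input \<sigma> m)) s i" if m: "1 \<le> m" and s: "s < D" for m s
  proof -
    define rs' where "rs' = concat (map (\<lambda>s. strikes s (\<sigma> s)) [s..<D]) @ replicate m (V D, D)"
    have "[0..<D] = [0..<s] @ [s..<D]" using s upt_add_eq_append[of 0 s "D - s"] by simp
    then have split: "input \<sigma> m = requests \<sigma> s @ rs'"
      by (simp add: input_def requests_def rs'_def)
    have "sorted (map snd (input \<sigma> m))" by (rule sorted_input)
    moreover have "rs' \<noteq> []" using m by (simp add: rs'_def)
    moreover have "s < snd r" if "r \<in> set rs'" for r
      using that s by (auto simp: rs'_def dest: set_strikes)
    moreover have "end_time 0 (requests \<sigma> s) \<le> s"
      using times_requests[OF last_in_set, of \<sigma> s] by (simp add: end_time_def)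
    ultimately have "ver (w, s) \<in> solution A n 1 (input \<sigma> m) \<longleftrightarrow>
        ver (w, s) \<in> decided A n 1 (adversary s) (Suc s)" for w
      unfolding adv split by (intro solution_arc_iff[OF online]) 
    then have eq: "gap (solution A n 1 (input \<sigma> m)) s i \<longleftrightarrow>
        gap (decided A n 1 (adversary s) (Suc s)) s i" for i
      by (simp add: gap_def)
    show ?thesis unfolding eq unfolding \<sigma>_def by (rule strike_level)
  qed
  then show thesis by (rule that)
qed

text \<open>The common measure of a step: summed over all steps, the offline solution pays at most 4
  times and the algorithm at least \<open>L\<close> times this amount.\<close>

definition cost :: "nat option \<Rightarrow> nat" where
  "cost x = (case x of None \<Rightarrow> 1 | Some i \<Rightarrow> d ^ i)"

lemma D_bounds: "i < L \<Longrightarrow> d ^ Suc i \<le> D" "i < L \<Longrightarrow> d ^ i \<le> D" "1 \<le> D"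
  unfolding D_def by (rule power_increasing; simp)+ simp

text \<open>Copies in all \<open>L\<close> disjoint levels are \<open>L\<close> arcs. At a strike in
  level \<open>i\<close>, the last arc into row \<open>s + 1\<close> lies left of the level, so the
  row has at least \<open>d ^ (i + 1) - d ^ i = L * d ^ i\<close> horizontal edges. Different steps
  use different rows.\<close>

lemma cost_online:
  assumes F: "feasible n 1 (input \<sigma> m) F"
    and \<sigma>: "\<And>s. s < D \<Longrightarrow> case \<sigma> s of None \<Rightarrow> \<forall>i<L. \<not> gap F s i | Some i \<Rightarrow> i < L \<and> gap F s i"
  shows "L * (\<Sum>s<D. cost (\<sigma> s)) \<le> card F"
proof -
  have fin: "finite F" and sub: "F \<subseteq> timeline_edges n" using F by (simp_all add: feasible_def)
  have finr: "finite {w. (w, s) \<in> P}" if "finite P" for s and P :: "(nat \<times> nat) set"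
    by (rule finite_subset[OF _ finite_imageI[OF that, of fst]]) force
  have row: "L * cost (\<sigma> s) \<le> card {w. (w, Suc s) \<in> Hs F} + card {w. (w, s) \<in> Vs F}" if s: "s < D" for s
  proof (cases "\<sigma> s")
    case None
    have "\<exists>w. V (Suc s) < w + d ^ Suc i \<and> w + d ^ i \<le> V (Suc s) \<and> ver (w, s) \<in> F" if "i < L" for i
      using \<sigma>[OF s] that None by (auto simp: gap_def)
    then obtain w where w: "\<And>i. i < L \<Longrightarrow> V (Suc s) < w i + d ^ Suc i \<and> w i + d ^ i \<le> V (Suc s) \<and> ver (w i, s) \<in> F"
      by metis
    have "inj_on w {..<L}"
    proof (rule linorder_inj_onI)
      fix i j assume "i < j" and ij: "i \<in> {..<L}" "j \<in> {..<L}"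
      then have "d ^ Suc i \<le> d ^ j" by (intro power_increasing) simp_all
      then show "w i \<noteq> w j" using w[of i] w[of j] ij by auto
    qed auto
    then have "L = card (w ` {..<L})" by (simp add: card_image)
    also have "\<dots> \<le> card {w. (w, s) \<in> Vs F}"
      using w finite_Vs[OF fin] by (intro card_mono finr) (auto simp: Vs_def)
    finally show ?thesis by (simp add: cost_def None)
  next
    case (Some i)
    then have i: "i < L" "gap F s i" using \<sigma>[OF s] by simp_all
    let ?c = "V (Suc s) - d ^ i"
    have "(?c, Suc s) \<in> set (input \<sigma> m)"
      using s Some by (auto simp: input_def requests_def strikes_def intro!: bexI[of _ s])
    then have "((1, 0), (?c, Suc s)) \<in> F\<^sup>*" using F by (simp add: feasible_def)
    from reach_row_entry[OF this sub] obtain w where w: "w \<le> ?c" "ver (w, s) \<in> F"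
      "\<And>x. w \<le> x \<Longrightarrow> x < ?c \<Longrightarrow> hor (x, Suc s) \<in> F" by auto
    have "d ^ i \<le> V (Suc s)" using D_bounds(2)[OF i(1)] by (simp add: V_def)
    then have "w + d ^ i \<le> V (Suc s)" using w(1) by simp
    then have "w + d ^ Suc i \<le> V (Suc s)" using i(2) w(2) unfolding gap_def by (meson not_le)
    then have "d ^ Suc i - d ^ i \<le> card {w..<?c}" by simp
    also have "\<dots> \<le> card {w. (w, Suc s) \<in> Hs F}"
      using w(3) finite_Hs[OF fin] by (intro card_mono finr) (auto simp: Hs_def)
    finally show ?thesis by (simp add: cost_def Some)
  qed
  have "L * (\<Sum>s<D. cost (\<sigma> s)) = (\<Sum>s<D. L * cost (\<sigma> s))" by (simp add: sum_distrib_left)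
  also have "\<dots> \<le> (\<Sum>s<D. card {w. (w, Suc s) \<in> Hs F} + card {w. (w, s) \<in> Vs F})"
    using row by (intro sum_mono) simp
  also have "\<dots> \<le> card (Hs F) + card (Vs F)"
    unfolding sum.distrib
    using sum_card_rows_le[OF finite_Hs[OF fin], of Suc D] sum_card_rows_le[OF finite_Vs[OF fin], of "\<lambda>s. s" D]
    by (intro add_mono) simp_all
  also have "\<dots> \<le> card F" by (rule card_Hs_Vs_le[OF fin])
  finally show ?thesis .
qed

end

section \<open>The lower bound\<close>

lemma reach_ver:
  assumes "((v0, 0), (w, a)) \<in> F\<^sup>*" "a \<le> b" "\<And>r. a \<le> r \<Longrightarrow> r < b \<Longrightarrow> ver (w, r) \<in> F"
  shows "((v0, 0), (w, b)) \<in> F\<^sup>*"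
  using assms(2,3)
proof (induction rule: dec_induct)
  case base
  then show ?case using assms(1) by simp
next
  case (step b)
  have "((w, b), (w, Suc b)) \<in> F" using step.prems[of b] step.hyps by (simp add: ver_def)
  with step.IH[OF step.prems] show ?case by (meson less_SucI rtrancl.rtrancl_into_rtrancl)
qed

lemma reach_hor:
  assumes "((v0, 0), (a, t)) \<in> F\<^sup>*" "a \<le> b" "\<And>x. a \<le> x \<Longrightarrow> x < b \<Longrightarrow> hor (x, t) \<in> F"
  shows "((v0, 0), (b, t)) \<in> F\<^sup>*"
  using assms(2,3)
proof (induction rule: dec_induct)
  case base
  then show ?case using assms(1) by simp
next
  case (step b)
  have "((b, t), (Suc b, t)) \<in> F" using step.prems[of b] step.hyps by (simp add: hor_def)
  with step.IH[OF step.prems] show ?case by (meson less_SucI rtrancl.rtrancl_into_rtrancl)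
qed

context diagonal
begin

lemma D_le_cost: "D \<le> (\<Sum>s<D. cost (\<sigma> s))"
proof -
  have "1 \<le> cost (\<sigma> s)" for s by (simp add: cost_def split: option.split)
  then have "(\<Sum>s<D. 1) \<le> (\<Sum>s<D. cost (\<sigma> s))" by (intro sum_mono)
  then show ?thesis by simp
qed

lemma input_cases:
  assumes "r \<in> set (input \<sigma> m)"
  obtains "r = (V D, D)" | s i where "s < D" "\<sigma> s = Some i" "r = (V (Suc s) - d ^ i, Suc s)"
proof -
  consider "r = (V D, D)" | s where "s < D" "r \<in> set (strikes s (\<sigma> s))"
    using assms by (auto simp: input_def requests_def)
  then show thesis
  proof cases
    case (2 s)
    then show thesis using that(2)[of s] by (cases "\<sigma> s") (simp_all add: strikes_def)
  qed (rule that(1))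
qed

text \<open>The frontier visited the column of a level \<open>i\<close> strike \<open>d ^ i\<close>
  steps earlier, so storing it since then takes \<open>d ^ i\<close> arcs; if that is before time 0,
  the initial row covers the column. The initial row and the staircase have \<open>3 * D\<close>
  edges.\<close>

lemma offline:
  assumes n: "V D \<le> n" and \<sigma>: "\<forall>s<D. \<forall>i. \<sigma> s = Some i \<longrightarrow> i < L"
  shows "\<exists>F. feasible n 1 (input \<sigma> m) F \<and> card F \<le> 4 * (\<Sum>s<D. cost (\<sigma> s))"
proof -
  define B where "B s = (case \<sigma> s of None \<Rightarrow> {} | Some i \<Rightarrow>
      (\<lambda>r. ver (V (Suc s) - d ^ i, r)) ` {Suc s - d ^ i..<Suc s})" for s
  define F where "F = (\<lambda>w. hor (w, 0)) ` {1..<V 0} \<union> (\<lambda>s. ver (V s, s)) ` {..<D}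
      \<union> (\<lambda>s. hor (V s, Suc s)) ` {..<D} \<union> (\<Union>s<D. B s)"
  have B: "finite (B s)" "card (B s) \<le> cost (\<sigma> s)" for s
  proof -
    show "finite (B s)" by (simp add: B_def split: option.split)
    have "card ((\<lambda>r. ver (V (Suc s) - d ^ i, r)) ` {Suc s - d ^ i..<Suc s}) \<le> d ^ i" for i
      using card_image_le[of "{Suc s - d ^ i..<Suc s}" "\<lambda>r. ver (V (Suc s) - d ^ i, r)"] by simp
    then show "card (B s) \<le> cost (\<sigma> s)" unfolding B_def cost_def by (auto split: option.split)
  qed
  have horn: "hor (w, t) \<in> timeline_edges n" if "1 \<le> w" "w + 1 \<le> n" for w t
    using that by (force simp: timeline_edges_def horizontal_edges_hor)
  have vern: "ver (w, t) \<in> timeline_edges n" if "1 \<le> w" "w \<le> n" for w t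
    using that by (force simp: timeline_edges_def arcs_ver)
  have col: "1 \<le> V (Suc s) - d ^ i" "V (Suc s) - d ^ i \<le> n" if "s < D" "\<sigma> s = Some i" for s i
    using D_bounds(2)[of i] \<sigma> that n by (simp_all add: V_def)
  have "F \<subseteq> timeline_edges n"
  proof -
    have "B s \<subseteq> timeline_edges n" if "s < D" for s
      using col[OF that] by (auto simp: B_def split: option.split intro!: vern)
    then show ?thesis using n unfolding F_def
      by (auto simp: V_def intro!: vern horn)
  qed
  moreover have "finite F" unfolding F_def using B(1) by auto
  moreover have stair: "((1, 0), (V s, s)) \<in> F\<^sup>*" if "s \<le> D" for s
    using that
  proof (induction s)
    case 0
    have "((1, 0), (1, 0)) \<in> F\<^sup>*" by simp
    then show ?case by (rule reach_hor) (auto simp: V_def F_def)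
  next
    case (Suc s)
    then have "ver (V s, s) \<in> F" "hor (V s, Suc s) \<in> F" by (auto simp: F_def)
    then have "((V s, s), (V s, Suc s)) \<in> F" "((V s, Suc s), (V (Suc s), Suc s)) \<in> F"
      by (simp_all add: ver_def hor_def V_def)
    moreover have "((1, 0), (V s, s)) \<in> F\<^sup>*" using Suc by simp
    ultimately show ?case by (meson rtrancl.rtrancl_into_rtrancl)
  qed
  moreover have "((1, 0), (V (Suc s) - d ^ i, Suc s)) \<in> F\<^sup>*" if s: "s < D" "\<sigma> s = Some i" for s i
  proof (rule reach_ver)
    show "Suc s - d ^ i \<le> Suc s" by simp
    show "ver (V (Suc s) - d ^ i, r) \<in> F" if "Suc s - d ^ i \<le> r" "r < Suc s" for r
      using that s by (auto simp: F_def B_def intro!: bexI[of _ s])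
    show "((1, 0), (V (Suc s) - d ^ i, Suc s - d ^ i)) \<in> F\<^sup>*"
    proof (cases "d ^ i \<le> Suc s")
      case True
      then have "V (Suc s) - d ^ i = V (Suc s - d ^ i)" by (simp add: V_def)
      then show ?thesis using stair[of "Suc s - d ^ i"] s(1) by simp
    next
      case False
      have "((1, 0), (1, 0)) \<in> F\<^sup>*" by simp
      then have "((1, 0), (V (Suc s) - d ^ i, 0)) \<in> F\<^sup>*"
        by (rule reach_hor) (use col[OF s] False in \<open>auto simp: V_def F_def\<close>)
      then show ?thesis using False by simp
    qed
  qed
  ultimately have "feasible n 1 (input \<sigma> m) F"
    unfolding feasible_def by (auto elim!: input_cases)
  moreover have "card F \<le> 4 * (\<Sum>s<D. cost (\<sigma> s))"
  proof -
    have "card F \<le> card ((\<lambda>w. hor (w, 0)) ` {1..<V 0}) + card ((\<lambda>s. ver (V s, s)) ` {..<D})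
      + card ((\<lambda>s. hor (V s, Suc s)) ` {..<D}) + card (\<Union>s<D. B s)"
      unfolding F_def by (intro order.trans[OF card_Un_le] add_mono order.refl)
    also have "\<dots> \<le> D + D + D + (\<Sum>s<D. cost (\<sigma> s))"
    proof (intro add_mono)
      show "card ((\<lambda>w. hor (w, 0)) ` {1..<V 0}) \<le> D"
        using card_image_le[of "{1..<V 0}" "\<lambda>w. hor (w, 0)"] by (simp add: V_def)
      show "card ((\<lambda>s. ver (V s, s)) ` {..<D}) \<le> D" "card ((\<lambda>s. hor (V s, Suc s)) ` {..<D}) \<le> D"
        using card_image_le[of "{..<D}"] by (metis card_lessThan finite_lessThan)+
      have "card (\<Union>s<D. B s) \<le> (\<Sum>s<D. card (B s))" by (rule card_UN_le) simp
      also have "\<dots> \<le> (\<Sum>s<D. cost (\<sigma> s))" using B(2) by (rule sum_mono)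
      finally show "card (\<Union>s<D. B s) \<le> (\<Sum>s<D. cost (\<sigma> s))" .
    qed
    finally show ?thesis using D_le_cost[of \<sigma>] by simp
  qed
  ultimately show ?thesis by blast
qed

lemma valid_input:
  assumes n: "V D \<le> n" and \<sigma>: "\<forall>s<D. \<forall>i. \<sigma> s = Some i \<longrightarrow> i < L"
  shows "valid_input n 1 (input \<sigma> m)"
  unfolding valid_input_def
proof (intro conjI sorted_input subsetI)
  show "\<exists>F. feasible n 1 (input \<sigma> m) F" using offline[OF n \<sigma>, of m] by blast
  fix r assume "r \<in> set (input \<sigma> m)"
  then show "r \<in> replicas n"
  proof (cases rule: input_cases)
    case 1
    then show ?thesis using n by (simp add: replicas_def V_def)
  next
    case (2 s i)
    then have "d ^ i \<le> D" using \<sigma> by (intro D_bounds(2)) blast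
    then have "1 \<le> V (Suc s) - d ^ i" "V (Suc s) - d ^ i \<le> n" using n 2(1) by (simp_all add: V_def)
    then show ?thesis using 2(3) by (simp add: replicas_def)
  qed
qed

lemma ratio_ge:
  assumes comp: "competitive A \<rho>" and n: "1 + 2 * D \<le> n" and N: "1 + D \<le> N"
  shows "real L / 4 \<le> \<rho> n N"
proof -
  obtain \<sigma> where \<sigma>: "\<And>m s. 1 \<le> m \<Longrightarrow> s < D \<Longrightarrow> case \<sigma> s of
      None \<Rightarrow> \<forall>i<L. \<not> gap (solution A n 1 (input \<sigma> m)) s i
    | Some i \<Rightarrow> i < L \<and> gap (solution A n 1 (input \<sigma> m)) s i" by (rule adversary) blast
  have lev: "\<forall>s<D. \<forall>i. \<sigma> s = Some i \<longrightarrow> i < L"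
    using \<sigma>[OF order.refl] by fastforce
  define m where "m = N - length (requests \<sigma> D)"
  have m: "1 \<le> m" and len: "length (input \<sigma> m) = N"
    using length_requests[of \<sigma> D] N by (simp_all add: m_def input_def)
  have VD: "V D \<le> n" using n by (simp add: V_def)
  let ?F = "solution A n 1 (input \<sigma> m)" and ?c = "\<Sum>s<D. cost (\<sigma> s)"
  have "feasible n 1 (input \<sigma> m) ?F"
    and le: "real (card ?F) \<le> \<rho> n N * real (opt_cost n 1 (input \<sigma> m))"
    using comp valid_input[OF VD lev, where m = m] n unfolding competitive_def len[symmetric] by simp_all
  then have "L * ?c \<le> card ?F" using \<sigma>[OF m] by (intro cost_online)
  then have "real L * real ?c \<le> real (card ?F)" by (metis of_nat_le_iff of_nat_mult)
  with le have lower: "real L * real ?c \<le> \<rho> n N * real (opt_cost n 1 (input \<sigma> m))" by linarith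
  have c: "0 < real ?c" using D_le_cost[of \<sigma>] D_bounds(3) by linarith
  obtain F where "feasible n 1 (input \<sigma> m) F" "card F \<le> 4 * ?c"
    using offline[OF VD lev, of m] by (elim exE conjE)
  then have "opt_cost n 1 (input \<sigma> m) \<le> 4 * ?c" using opt_cost_le[of n 1 "input \<sigma> m" F] by linarith
  then have opt: "real (opt_cost n 1 (input \<sigma> m)) \<le> 4 * real ?c" by linarith
  \<comment> \<open>The bound on the optimum may be multiplied by \<open>\<rho> n N\<close> only
    once this is known to be positive.\<close>
  have "0 < real L * real ?c" using L c by simp
  then have "0 < \<rho> n N"
    using lower by (metis less_le_trans mult_nonpos_nonneg not_le of_nat_0_le_iff)
  then have "\<rho> n N * real (opt_cost n 1 (input \<sigma> m)) \<le> \<rho> n N * (4 * real ?c)"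
    using opt by (intro mult_left_mono) simp_all
  with lower have "real L * real ?c \<le> (4 * \<rho> n N) * real ?c" by (simp add: algebra_simps)
  then show ?thesis using c by simp
qed

end

text \<open>A request at time 1 forces a nonzero optimum. This settles sizes too small for a
  diagonal instance with \<open>L \<ge> 1\<close>.\<close>

lemma ratio_ge_1:
  assumes comp: "competitive A \<rho>" and "1 \<le> n" "1 \<le> N"
  shows "1 \<le> \<rho> n N"
proof -
  define rs :: "replica list" where "rs = replicate N (1, 1)"
  have rs: "set rs = {(1, 1)}" "length rs = N" using assms(3) by (auto simp: rs_def)
  have edge: "((1, 0), (1, 1)) \<in> timeline_edges n"
    using assms(2) by (auto simp: timeline_edges_def arcs_def)
  have "feasible n 1 rs {((1, 0), (1, 1))}"
    using edge rs by (auto simp: feasible_def)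
  then have vi: "valid_input n 1 rs" and ex: "\<exists>F. feasible n 1 rs F"
    using assms(2) rs by (auto simp: valid_input_def replicas_def rs_def)
  let ?F = "solution A n 1 rs"
  have F: "feasible n 1 rs ?F" "real (card ?F) \<le> \<rho> n N * real (opt_cost n 1 rs)"
    using comp vi assms(2) rs(2) unfolding competitive_def by auto
  obtain F' where F': "feasible n 1 rs F'" "card F' = opt_cost n 1 rs" using ex opt_costE by metis
  have "F' \<noteq> {}" using F'(1) rs(1) by (auto simp: feasible_def)
  then have "0 < opt_cost n 1 rs" using F' by (metis card_gt_0_iff feasible_def)
  moreover have "real (opt_cost n 1 rs) \<le> \<rho> n N * real (opt_cost n 1 rs)"
    using opt_cost_le[OF F(1)] F(2) by linarith
  ultimately show ?thesis by simp
qed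

text \<open>Let \<open>M = L + 1\<close> and \<open>y = ln x\<close>, so
  \<open>y \<le> 2 * M * ln (M + 1)\<close>. If \<open>ln y\<close> is at least half of
  \<open>ln (M + 1)\<close>, the quotient is at most \<open>4 * M\<close>. Otherwise
  \<open>y ^ 2 \<le> M + 1 \<le> 2 * M\<close>, and \<open>ln y \<ge> 1 - 1 / y\<close> with
  \<open>y \<ge> ln 3\<close> gives \<open>2 * M / (ln 3 - 1)\<close>.\<close>

lemma log_over_loglog_le:
  fixes L x :: nat
  assumes x: "3 \<le> x" "x \<le> 2 * (L + 2) ^ (L + 1)"
  shows "log_over_loglog x \<le> (4 + 2 / (ln 3 - 1)) * real (L + 1)"
proof -
  define M y where "M = real (L + 1)" and "y = ln (real x)"
  have M: "1 \<le> M" by (simp add: M_def)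
  have l3: "1 < ln (3::real)" using one_less_ln[of 3] by simp
  have y3: "ln 3 \<le> y" unfolding y_def using x(1) by simp
  have y: "1 < y" using l3 y3 by linarith
  have z: "0 < ln y" using y by simp
  have lM: "0 < ln (M + 1)" using M by simp
  have "real x \<le> 2 * (M + 1) ^ (L + 1)"
  proof -
    have "real x \<le> real (2 * (L + 2) ^ (L + 1))" using x(2) by (rule of_nat_mono)
    also have "real (2 * (L + 2) ^ (L + 1)) = 2 * (M + 1) ^ (L + 1)"
    proof -
      have "M + 1 = real (L + 2)" by (simp add: M_def)
      then show ?thesis by (simp only: of_nat_mult of_nat_power of_nat_numeral)
    qed
    finally show ?thesis .
  qed
  then have "y \<le> ln (2 * (M + 1) ^ (L + 1))" unfolding y_def using x(1) by (intro ln_mono) simp_all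
  also have "\<dots> = ln 2 + M * ln (M + 1)"
    using M by (subst ln_mult, simp_all only: ln_realpow M_def) simp_all
  finally have "y \<le> ln 2 + M * ln (M + 1)" .
  moreover have "ln 2 \<le> ln (M + 1)" using M by simp
  moreover have "ln (M + 1) \<le> M * ln (M + 1)" using M lM by simp
  ultimately have yM: "y \<le> 2 * M * ln (M + 1)" by linarith
  have "y / ln y \<le> (4 + 2 / (ln 3 - 1)) * M"
  proof (cases "ln (M + 1) / 2 \<le> ln y")
    case True
    have "2 * M * ln (M + 1) \<le> 4 * M * ln y" using True M by (simp add: mult_left_mono)
    then have "y / ln y \<le> 4 * M" using z yM by (simp add: pos_divide_le_eq)
    also have "\<dots> \<le> (4 + 2 / (ln 3 - 1)) * M" using l3 M by (intro mult_right_mono) simp_all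
    finally show ?thesis .
  next
    case False
    then have "ln (y\<^sup>2) \<le> ln (M + 1)" using y by (simp add: ln_realpow)
    then have y2: "y\<^sup>2 \<le> M + 1" using y M by simp
    have "ln (1 / y) \<le> 1 / y - 1" using y by (intro ln_le_minus_one) simp
    then have "1 - 1 / y \<le> ln y" using y by (simp add: ln_div)
    then have "y - 1 \<le> y * ln y" using y by (simp add: field_simps)
    then have "y / ln y \<le> y\<^sup>2 / (y - 1)" using y z
      by (simp add: divide_simps power2_eq_square mult.assoc)
    also have "\<dots> \<le> (2 * M) / (ln 3 - 1)"
      using y2 y3 l3 M by (intro frac_le) simp_all
    also have "\<dots> \<le> (4 + 2 / (ln 3 - 1)) * M" using M by (simp add: algebra_simps)
    finally show ?thesis .
  qed
  then show ?thesis using x(1) by (simp add: log_over_loglog_def y_def M_def)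
qed

text \<open>\<open>L\<close> is the largest parameter whose instance fits into size
  \<open>x\<close>; that the next one does not fit bounds \<open>x\<close>.\<close>

lemma ex_parameter:
  assumes "3 \<le> (x::nat)"
  obtains L where "1 + 2 * (L + 1) ^ L \<le> x" "x \<le> 2 * (L + 2) ^ (L + 1)"
proof -
  let ?P = "\<lambda>L. 1 + 2 * (L + 1) ^ L \<le> x"
  have "?P 0" using assms by simp
  moreover have "L \<le> x" if "?P L" for L
  proof -
    have "L \<le> (L + 1) ^ L" by (cases "L = 0") (simp_all add: self_le_power order.trans[OF _ self_le_power])
    then show ?thesis using that by linarith
  qed
  ultimately have P: "?P (GREATEST L. ?P L)" "\<And>L. ?P L \<Longrightarrow> L \<le> (GREATEST L. ?P L)"
    using GreatestI_nat[of ?P 0 x] Greatest_le_nat[of ?P _ x] by blast+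
  define L where "L = (GREATEST L. ?P L)"
  have "\<not> ?P (L + 1)" using P(2)[of "L + 1"] unfolding L_def[symmetric] by auto
  then have "x \<le> 2 * (L + 2) ^ (L + 1)" by (simp add: add.commute)
  then show thesis using that[of L] P(1) unfolding L_def[symmetric] by blast
qed

text \<open>\<open>dmcd_ratio\<close> is the smaller of two values of
  \<open>log_over_loglog\<close>, one of which is taken at \<open>min n N\<close>, so no
  monotonicity is involved. The 5 comes from adding \<open>1 \<le> \<rho> n N\<close> to
  \<open>L \<le> 4 * \<rho> n N\<close>.\<close>

lemma competitive_lower_bound:
  assumes comp: "competitive A \<rho>" and "1 \<le> n" "1 \<le> N"
  shows "1 / (5 * (4 + 2 / (ln 3 - 1))) * dmcd_ratio n N \<le> \<rho> n N"
proof -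
  define C where "C = 4 + 2 / (ln 3 - (1::real))"
  have "1 < ln (3::real)" using one_less_ln[of 3] by simp
  then have C: "4 \<le> C" by (simp add: C_def)
  define x where "x = min n N"
  have x: "1 \<le> x" "dmcd_ratio n N \<le> log_over_loglog x"
    using assms(2,3) by (auto simp: x_def dmcd_ratio_def min_def)
  have one: "1 \<le> \<rho> n N" using ratio_ge_1[OF assms] .
  have "log_over_loglog x \<le> 5 * C * \<rho> n N"
  proof (cases "x < 3")
    case True
    have "1 * 1 \<le> (5 * C) * \<rho> n N" using C one by (intro mult_mono) simp_all
    then show ?thesis using True by (simp add: log_over_loglog_def)
  next
    case False
    then have x3: "3 \<le> x" by simp
    obtain L where bounds: "1 + 2 * (L + 1) ^ L \<le> x" "x \<le> 2 * (L + 2) ^ (L + 1)"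
      using ex_parameter[OF x3] .
    have "real L / 4 \<le> \<rho> n N"
    proof (cases "L = 0")
      case False
      then interpret diagonal A n L
        using comp by unfold_locales (simp_all add: competitive_def)
      show ?thesis using bounds(1) by (intro ratio_ge[OF comp]) (simp_all add: D_def x_def)
    qed (use one in simp)
    then have "real (L + 1) \<le> 5 * \<rho> n N" using one by simp
    then have "C * real (L + 1) \<le> C * (5 * \<rho> n N)" using C by (intro mult_left_mono) simp_all
    then show ?thesis using log_over_loglog_le[OF x3 bounds(2)] unfolding C_def[symmetric] by simp
  qed
  then have "dmcd_ratio n N \<le> 5 * C * \<rho> n N" using x(2) by linarith
  then show ?thesis using C unfolding C_def[symmetric] by (simp add: pos_divide_le_eq mult.commute)
qed

theorem theorem4:
  shows "(\<exists>A C. C > 0 \<and> competitive A (\<lambda>n N. C * dmcd_ratio n N)) \<and>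
    (\<exists>c > 0. \<forall>A \<rho>. competitive A \<rho> \<longrightarrow>
       (\<forall>n \<ge> 1. \<forall>N \<ge> 1. \<rho> n N \<ge> c * dmcd_ratio n N))"
proof
  show "\<exists>A C. C > 0 \<and> competitive A (\<lambda>n N. C * dmcd_ratio n N)"
    by (intro exI[of _ alg] exI[of _ 2497]) (simp add: competitive_alg)
  have "1 < ln (3::real)" using one_less_ln[of 3] by simp
  then have "0 < 1 / (5 * (4 + 2 / (ln 3 - (1::real))))" by (simp add: add_pos_pos)
  then show "\<exists>c > 0. \<forall>A \<rho>. competitive A \<rho> \<longrightarrow>
       (\<forall>n \<ge> 1. \<forall>N \<ge> 1. \<rho> n N \<ge> c * dmcd_ratio n N)"
    using competitive_lower_bound by blast
qed

end
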